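(* Let $K,\sigma>0$. (i) If $K<\sigma$, then for every $d\ge1$ there is a constant $C=C(\sigma,K,d)$ such that for every $K$-subgaussian distribution $\mathbb{P}$ on $\mathbb{R}^d$ and every $n\ge 1$, $$\mathbb{E}\left[D_{KL}\big(\mathbb{P}_n*\mathcal{N}(0,\sigma^2I_d)\,\big\|\,\mathbb{P}*\mathcal{N}(0,\sigma^2I_d)\big)\right]\le\frac{C}{n}.$$ (ii) If $K>\sigma$, then there exists a $K$-subgaussian distribution $\mathbb{P}$ on $\mathbb{R}$ such that $$\mathbb{E}\left[D_{KL}\big(\mathbb{P}_n*\mathcal{N}(0,\sigma^2)\,\big\|\,\mathbb{P}*\mathcal{N}(0,\sigma^2)\big)\right]=\omega\left(\frac1n\right),$$ i.e. $n$ times the left-hand side tends to $\infty$ as $n\to\infty$.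
   Context: A probability distribution $\mathbb{P}$ on $\mathbb{R}^d$ is $K$-subgaussian if, for $X\sim\mathbb{P}$, $\mathbb{E}[e^{\langle\lambda, X-\mathbb{E}[X]\rangle}]\le e^{\frac12K^2\|\lambda\|^2}$ for all $\lambda\in\mathbb{R}^d$. $\mathbb{P}_n=\frac1n\sum_{i=1}^n\delta_{X_i}$ is the empirical measure of i.i.d. samples $X_1,\dots,X_n\sim\mathbb{P}$; the outer expectation is over these samples. $*$ is convolution of measures. $D_{KL}(\mu\|\nu)=\int f\log f\,d\nu$ with $f=\frac{d\mu}{d\nu}$ when $\mu\ll\nu$. *)

theory Defs
  imports "HOL-Probability.Probability"
begin

text \<open>
  The integrability condition says that the mean exists (a Bochner integral is 0 otherwise).
\<close>

definition subgaussian :: "real \<Rightarrow> 'a::euclidean_space measure \<Rightarrow> bool" where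
  "subgaussian K P \<longleftrightarrow>
     prob_space P \<and> sets P = sets borel \<and> integrable P (\<lambda>x. x) \<and>
     (\<forall>l. (\<integral>\<^sup>+x. ennreal (exp (l \<bullet> (x - (\<integral>y. y \<partial>P)))) \<partial>P)
            \<le> ennreal (exp (1/2 * K\<^sup>2 * (norm l)\<^sup>2)))"

definition gaussian :: "real \<Rightarrow> 'a::euclidean_space measure" where
  "gaussian \<sigma> = density lborel (\<lambda>x. ennreal (\<Prod>b\<in>Basis. normal_density 0 \<sigma> (x \<bullet> b)))"

lemma gaussian_real: "gaussian \<sigma> = density lborel (\<lambda>x::real. ennreal (normal_density 0 \<sigma> x))"
  by (simp add: gaussian_def)

lemma gaussian_eq:
  assumes "\<sigma> > 0"
  shows "gaussian \<sigma> = density lborel (\<lambda>x::'a::euclidean_space.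
           ennreal (exp (- (norm x)\<^sup>2 / (2 * \<sigma>\<^sup>2)) / sqrt (2 * pi * \<sigma>\<^sup>2) ^ DIM('a)))"
proof -
  have "(\<Prod>b\<in>Basis. normal_density 0 \<sigma> (x \<bullet> b))
          = exp (- (norm x)\<^sup>2 / (2 * \<sigma>\<^sup>2)) / sqrt (2 * pi * \<sigma>\<^sup>2) ^ DIM('a)" for x :: 'a
  proof -
    have "(norm x)\<^sup>2 = (\<Sum>b\<in>Basis. (x \<bullet> b)\<^sup>2)"
      unfolding power2_norm_eq_inner by (subst euclidean_inner) (simp add: power2_eq_square)
    then show ?thesis
      by (simp add: normal_density_def prod_dividef exp_sum[symmetric] sum_negf
          sum_divide_distrib)
  qed
  then show ?thesis
    by (simp add: gaussian_def)
qed

definition empirical_measure :: "nat \<Rightarrow> (nat \<Rightarrow> 'a::topological_space) \<Rightarrow> 'a measure" where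
  "empirical_measure n X = distr (uniform_count_measure {..<n}) borel X"

lemma emeasure_empirical_measure:
  assumes "n \<ge> 1" "A \<in> sets borel"
  shows "emeasure (empirical_measure n X) A = ennreal (1 / real n * (\<Sum>i<n. indicator A (X i)))"
proof -
  have m: "X \<in> measurable (uniform_count_measure {..<n}) borel"
    by (auto simp: measurable_def space_uniform_count_measure sets_uniform_count_measure)
  have "emeasure (empirical_measure n X) A
          = emeasure (uniform_count_measure {..<n}) (X -` A \<inter> {..<n})"
    using assms m by (simp add: empirical_measure_def emeasure_distr space_uniform_count_measure)
  also have "\<dots> = ennreal (real (card (X -` A \<inter> {..<n})) / real n)"
    using assms by (subst emeasure_uniform_count_measure) auto
  also have "real (card (X -` A \<inter> {..<n})) = (\<Sum>i<n. indicator A (X i))"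
    by (simp add: indicator_def sum.If_cases Int_def conj_commute)
  finally show ?thesis
    by simp
qed

text \<open>
  The library's \<^const>\<open>KL_divergence\<close> is real-valued, so it takes a junk value where the divergence
  is infinite.  The definition below takes values in \<open>[0, \<infinity>]\<close>: the negative part of
  \<open>f log f\<close> is bounded, so for a finite measure \<open>\<nu>\<close> non-integrability means that the integral
  is \<open>\<infinity>\<close>.  By \<open>KL_integral_nonneg\<close> the truncation at 0 done by \<^const>\<open>ennreal\<close> is vacuous for
  probability measures.
  Note the argument order: \<^term>\<open>absolutely_continuous \<nu> \<mu>\<close> is \<open>\<mu> \<lless> \<nu>\<close>, and
  \<^term>\<open>RN_deriv \<nu> \<mu>\<close> is \<open>d\<mu>/d\<nu>\<close>.
\<close>

definition KL_div :: "'a measure \<Rightarrow> 'a measure \<Rightarrow> ennreal" where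
  "KL_div \<mu> \<nu> =
     (let f = (\<lambda>x. enn2real (RN_deriv \<nu> \<mu> x)) in
      if absolutely_continuous \<nu> \<mu> \<and> sets \<mu> = sets \<nu> \<and> integrable \<nu> (\<lambda>x. f x * ln (f x))
      then ennreal (\<integral>x. f x * ln (f x) \<partial>\<nu>)
      else \<infinity>)"

lemma
  assumes "prob_space \<mu>" "prob_space \<nu>" "absolutely_continuous \<nu> \<mu>" "sets \<mu> = sets \<nu>"
  defines "f \<equiv> (\<lambda>x. enn2real (RN_deriv \<nu> \<mu> x))"
  shows KL_integral_eq: "(\<integral>x. f x * ln (f x) \<partial>\<nu>) = KL_divergence (exp 1) \<nu> \<mu>"
    and KL_integral_nonneg:
      "integrable \<nu> (\<lambda>x. f x * ln (f x)) \<Longrightarrow> 0 \<le> (\<integral>x. f x * ln (f x) \<partial>\<nu>)"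
proof -
  interpret \<mu>: prob_space \<mu> by fact
  interpret \<nu>: prob_space \<nu> by fact
  interpret \<nu>: information_space \<nu> "exp 1"
    by standard simp
  have ln: "log (exp 1) = ln"
    by (simp add: log_def fun_eq_iff)
  have fm: "f \<in> borel_measurable \<nu>"
    unfolding f_def by measurable
  have "AE x in \<nu>. RN_deriv \<nu> \<mu> x \<noteq> \<infinity>"
    using assms by (intro \<nu>.RN_deriv_finite) (auto intro: \<mu>.sigma_finite_measure_axioms)
  then have "AE x in \<nu>. RN_deriv \<nu> \<mu> x = ennreal (f x)"
    by eventually_elim (simp add: f_def less_top)
  then have "density \<nu> (\<lambda>x. ennreal (f x)) = density \<nu> (RN_deriv \<nu> \<mu>)"
    using fm by (intro density_cong) auto
  then have d: "density \<nu> (\<lambda>x. ennreal (f x)) = \<mu>"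
    using assms \<nu>.density_RN_deriv by simp
  show eq: "(\<integral>x. f x * ln (f x) \<partial>\<nu>) = KL_divergence (exp 1) \<nu> \<mu>"
    using \<nu>.KL_density[of "exp 1" f] fm d by (simp add: ln f_def)
  show "0 \<le> (\<integral>x. f x * ln (f x) \<partial>\<nu>)" if "integrable \<nu> (\<lambda>x. f x * ln (f x))"
    using \<nu>.KL_nonneg[of f] that fm d \<mu>.prob_space_axioms eq by (simp add: ln f_def)
qed

text \<open>
  The i.i.d. sample \<open>X\<^sub>1, \<dots>, X\<^sub>n\<close> is the coordinate process, indexed by \<open>{..<n}\<close>, on the
  \<open>n\<close>-fold product space.
  The class \<open>ordered_euclidean_space\<close> is only there because the library's convolution \<open>\<star>\<close>
  demands it; \<open>real\<close> and \<open>real ^ 'd\<close> are instances.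
\<close>

definition expected_smoothed_KL ::
    "real \<Rightarrow> 'a::ordered_euclidean_space measure \<Rightarrow> nat \<Rightarrow> ennreal" where
  "expected_smoothed_KL \<sigma> P n =
     (\<integral>\<^sup>+X. KL_div (empirical_measure n X \<star> gaussian \<sigma>) (P \<star> gaussian \<sigma>)
        \<partial>(\<Pi>\<^sub>M i\<in>{..<n}. P))"

end

theory Submission
  imports Defs
begin

text \<open>
  Let \<open>s\<close> be the density of \<open>P * N(0, \<sigma>\<^sup>2 I)\<close> and \<open>g\<close> the Gaussian kernel.  At a fixed point
  \<open>y\<close> the density of the smoothed empirical measure is the average of the i.i.d. bounded variables
  \<open>g (y - X i)\<close>, whose mean is \<open>s y\<close>.  The divergence is the integral of the nonnegative
  function \<open>s h (s\<^sub>n / s)\<close> with \<open>h t = t ln t - t + 1\<close>, and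
  \<open>u\<^sup>2 / 2 - u\<^sup>3 / 6 \<le> h (1 + u) \<le> u\<^sup>2\<close>.  By Tonelli the expectation can be taken pointwise
  in \<open>y\<close>, where it involves only the second and third moments of a sum of i.i.d. centred
  variables.  Thus everything depends on
  \<open>I = \<integral> E [g (y - X)\<^sup>2] / s y dy\<close>: the expected divergence is at most \<open>I / n\<close>
  (\<open>expected_smoothed_KL_le\<close>), and if \<open>I\<close> is infinite, then \<open>n\<close> times the expected divergence
  tends to infinity by Fatou's lemma (\<open>expected_smoothed_KL_superlinear\<close>).

  If \<open>K < \<sigma>\<close>, then \<open>I\<close> is bounded in terms of \<open>K\<close>, \<open>\<sigma>\<close> and the dimension.  With the mean at the
  origin, \<open>E [g (y - X)\<^sup>2]\<close> is split according to whether \<open>X\<close> is at distance at least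
  \<open>\<epsilon> |y|\<close> from \<open>y\<close>.  The far part is at most \<open>exp (- \<epsilon>\<^sup>2 |y|\<^sup>2 / (2 \<sigma>\<^sup>2)) s y\<close> up to a
  constant.  In the near part \<open>X\<close> lies in a half space at distance \<open>(1 - \<epsilon>) |y|\<close> from the mean,
  which has probability at most \<open>exp (- (1 - \<epsilon>)\<^sup>2 |y|\<^sup>2 / (2 K\<^sup>2))\<close>, while \<open>s y\<close> is at least
  \<open>exp (- |y|\<^sup>2 / (2 \<sigma>\<^sup>2))\<close> up to a constant, by Jensen's inequality
  (\<open>mixture_second_moment_le\<close>, \<open>mixture_density_ge\<close>).  Both quotients are integrable in \<open>y\<close> for
  small \<open>\<epsilon>\<close>.

  If \<open>K > \<sigma>\<close>, take atoms \<open>\<plusminus>B ^ k\<close> of mass about \<open>exp (- \<beta> B ^ (2 k))\<close> and the rest of the mass at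
  the origin, where \<open>1 / (2 K\<^sup>2) < \<beta> < 1 / (2 \<sigma>\<^sup>2)\<close>.  This is \<open>K\<close>-subgaussian for large \<open>B\<close>
  (\<open>symmetric_discrete_subgaussian\<close>).  Since \<open>\<beta> < 1 / (2 \<sigma>\<^sup>2)\<close>, near the atom \<open>B ^ k\<close> the
  density \<open>s\<close> is dominated by that atom, and so the integrand of \<open>I\<close> stays away from 0 on an
  interval of length one (\<open>sparse_atoms_infinite_integral\<close>).  There are infinitely many such
  intervals, whence \<open>I\<close> is infinite.
\<close>

section \<open>The divergence as the integral of a nonnegative function\<close>

text \<open>
  For a density \<open>t\<close> the terms \<open>- t + 1\<close> integrate to zero, so they do not change the
  divergence, and they make the integrand nonnegative.  Hence no integrability question arises
  when orders of integration are exchanged or limits are taken.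
\<close>

definition kl_fun :: "real \<Rightarrow> real" where
  "kl_fun t = t * ln t - t + 1"

text \<open>This is the comparison of the divergence with the \<open>\<chi>\<^sup>2\<close>-divergence.\<close>

lemma kl_fun_le_square:
  assumes "t > 0" shows "kl_fun t \<le> (t - 1)\<^sup>2"
proof -
  have "t * ln t \<le> t * (t - 1)"
    using assms ln_le_minus_one[of t] by (intro mult_left_mono) auto
  then show ?thesis
    by (simp add: kl_fun_def power2_eq_square algebra_simps)
qed

lemma ln_minus_quadratic_mono:
  fixes a b :: real
  assumes "0 < a" "a \<le> b"
  shows "ln a - (a - 1) + (a - 1)\<^sup>2 / 2 \<le> ln b - (b - 1) + (b - 1)\<^sup>2 / 2"
proof (rule DERIV_nonneg_imp_nondecreasing[OF assms(2)])
  fix x assume x: "a \<le> x" "x \<le> b"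
  with assms have "x > 0" by simp
  have "1 / x - 1 + (x - 1) = (x - 1)\<^sup>2 / x"
    using \<open>x > 0\<close> by (simp add: field_simps power2_eq_square)
  also have "\<dots> \<ge> 0"
    using \<open>x > 0\<close> by simp
  finally have "1 / x - 1 + (x - 1) \<ge> 0" .
  moreover have "((\<lambda>x. ln x - (x - 1) + (x - 1)\<^sup>2 / 2) has_real_derivative (1 / x - 1 + (x - 1))) (at x)"
    using \<open>x > 0\<close> by (auto intro!: derivative_eq_intros simp: field_simps)
  ultimately show "\<exists>y. ((\<lambda>x. ln x - (x - 1) + (x - 1)\<^sup>2 / 2) has_real_derivative y) (at x) \<and> 0 \<le> y"
    by blast
qed

text \<open>
  The right-hand side is the third-order Taylor polynomial at 1.  The fourth derivative
  \<open>2 / t ^ 3\<close> is positive, so the polynomial is a global lower bound.  With a polynomial bound the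
  expectation over the sample is computed exactly from the second and third moments, and no
  concentration argument is needed for the lower bound.
\<close>

lemma kl_fun_ge_cubic:
  assumes "t > 0" shows "(t - 1)\<^sup>2 / 2 - (t - 1) ^ 3 / 6 \<le> kl_fun t"
proof -
  define F where "F x = kl_fun x - ((x - 1)\<^sup>2 / 2 - (x - 1) ^ 3 / 6)" for x
  define F' where "F' x = ln x - (x - 1) + (x - 1)\<^sup>2 / 2" for x :: real
  have D: "(F has_real_derivative F' x) (at x)" if "x > 0" for x
    unfolding F_def F'_def kl_fun_def using that
    by (auto intro!: derivative_eq_intros simp: field_simps power2_eq_square power3_eq_cube)
  have "F 1 \<le> F t"
  proof (cases "t \<le> 1")
    case True
    show ?thesis
    proof (rule DERIV_nonpos_imp_nonincreasing[OF True])
      fix x assume x: "t \<le> x" "x \<le> 1"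
      then have "F' x \<le> F' 1"
        unfolding F'_def using assms by (intro ln_minus_quadratic_mono) auto
      then show "\<exists>y. (F has_real_derivative y) (at x) \<and> y \<le> 0"
        using D[of x] x assms by (auto simp: F'_def)
    qed
  next
    case False
    then have "1 \<le> t" by simp
    then show ?thesis
    proof (rule DERIV_nonneg_imp_nondecreasing)
      fix x assume x: "1 \<le> x" "x \<le> t"
      then have "F' 1 \<le> F' x"
        unfolding F'_def using assms by (intro ln_minus_quadratic_mono) auto
      then show "\<exists>y. (F has_real_derivative y) (at x) \<and> 0 \<le> y"
        using D[of x] x assms by (auto simp: F'_def)
    qed
  qed
  then show ?thesis
    by (simp add: F_def kl_fun_def)
qed

lemma kl_fun_nonneg:
  assumes "t > 0" shows "0 \<le> kl_fun t"
proof -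
  have "ln (1 / t) \<le> 1 / t - 1"
    using assms by (intro ln_le_minus_one) simp
  then have "t * (1 - 1 / t) \<le> t * ln t"
    using assms by (intro mult_left_mono) (simp_all add: ln_div)
  then show ?thesis
    using assms by (simp add: kl_fun_def algebra_simps)
qed

lemma borel_measurable_kl_fun[measurable]: "kl_fun \<in> borel_measurable borel"
  unfolding kl_fun_def[abs_def] by measurable

text \<open>
  The equation also holds when both sides are infinite: \<open>f ln f\<close> and \<open>kl_fun f\<close> differ by the
  integrable function \<open>f - 1\<close>.
\<close>

lemma KL_div_density_prob_space:
  assumes "prob_space N"
    and [measurable]: "f \<in> borel_measurable N"
    and pos: "\<And>x. 0 < f x"
    and one: "(\<integral>\<^sup>+x. ennreal (f x) \<partial>N) = 1"
  shows "KL_div (density N (\<lambda>x. ennreal (f x))) N = (\<integral>\<^sup>+x. ennreal (kl_fun (f x)) \<partial>N)"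
proof -
  interpret prob_space N by fact
  let ?M = "density N (\<lambda>x. ennreal (f x))"
  define g where "g x = enn2real (RN_deriv N ?M x)" for x
  have [measurable]: "g \<in> borel_measurable N"
    unfolding g_def by measurable
  have "AE x in N. ennreal (f x) = RN_deriv N ?M x"
    by (intro RN_deriv_unique) simp_all
  then have eq: "AE x in N. g x * ln (g x) = f x * ln (f x)"
  proof eventually_elim
    fix x assume "ennreal (f x) = RN_deriv N ?M x"
    then show "g x * ln (g x) = f x * ln (f x)"
      using pos[of x] by (simp add: g_def flip: \<open>ennreal (f x) = RN_deriv N ?M x\<close>)
  qed
  have f: "integrable N f" "integral\<^sup>L N f = 1"
    using one pos by (auto intro!: integrableI_nonneg simp: less_imp_le integral_eq_nn_integral)
  have ac: "absolutely_continuous N ?M"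
    by (intro absolutely_continuousI_density) simp
  have int_iff: "integrable N (\<lambda>x. g x * ln (g x)) \<longleftrightarrow> integrable N (\<lambda>x. f x * ln (f x))"
    using eq by (intro integrable_cong_AE) simp_all
  have KL: "KL_div ?M N = (if integrable N (\<lambda>x. f x * ln (f x))
      then ennreal (\<integral>x. f x * ln (f x) \<partial>N) else \<infinity>)"
    using ac eq unfolding KL_div_def
    by (simp add: g_def[symmetric] int_iff integral_cong_AE[OF _ _ eq])
  show ?thesis
  proof (cases "integrable N (\<lambda>x. f x * ln (f x))")
    case True
    then have int: "integrable N (\<lambda>x. kl_fun (f x))"
      unfolding kl_fun_def using f by (intro Bochner_Integration.integrable_add Bochner_Integration.integrable_diff) auto
    have "(\<integral>x. kl_fun (f x) \<partial>N) = (\<integral>x. f x * ln (f x) \<partial>N)"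
      unfolding kl_fun_def using True f by (simp add: prob_space)
    then show ?thesis
      using True KL int kl_fun_nonneg[OF pos] by (simp add: nn_integral_eq_integral)
  next
    case False
    have "\<not> integrable N (\<lambda>x. kl_fun (f x))"
    proof
      assume "integrable N (\<lambda>x. kl_fun (f x))"
      then have "integrable N (\<lambda>x. kl_fun (f x) + f x - 1)"
        using f by (intro Bochner_Integration.integrable_add Bochner_Integration.integrable_diff) auto
      with False show False
        by (simp add: kl_fun_def)
    qed
    then have "(\<integral>\<^sup>+x. ennreal (kl_fun (f x)) \<partial>N) = \<infinity>"
      using kl_fun_nonneg[OF pos] by (simp add: integrable_iff_bounded flip: less_top)
    then show ?thesis
      using False KL by simp
  qed
qed

lemma KL_div_densities:
  fixes r s :: "'a \<Rightarrow> real"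
  assumes [measurable]: "r \<in> borel_measurable M" "s \<in> borel_measurable M"
    and pos: "\<And>x. 0 < r x" "\<And>x. 0 < s x"
    and one: "(\<integral>\<^sup>+x. ennreal (r x) \<partial>M) = 1" "(\<integral>\<^sup>+x. ennreal (s x) \<partial>M) = 1"
  shows "KL_div (density M (\<lambda>x. ennreal (r x))) (density M (\<lambda>x. ennreal (s x)))
       = (\<integral>\<^sup>+x. ennreal (s x * kl_fun (r x / s x)) \<partial>M)"
proof -
  let ?N = "density M (\<lambda>x. ennreal (s x))"
  have N: "prob_space ?N"
    using one by (intro prob_spaceI) (simp add: emeasure_density)
  have r: "ennreal (s x) * ennreal (r x / s x) = ennreal (r x)" for x
    using pos[of x] by (simp add: less_imp_le flip: ennreal_mult)
  have "KL_div (density ?N (\<lambda>x. ennreal (r x / s x))) ?N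
      = (\<integral>\<^sup>+x. ennreal (kl_fun (r x / s x)) \<partial>?N)"
    using pos one by (intro KL_div_density_prob_space N) (simp_all add: nn_integral_density r)
  also have "density ?N (\<lambda>x. ennreal (r x / s x)) = density M (\<lambda>x. ennreal (r x))"
    by (simp add: density_density_eq r)
  also have "(\<integral>\<^sup>+x. ennreal (kl_fun (r x / s x)) \<partial>?N) = (\<integral>\<^sup>+x. ennreal (s x * kl_fun (r x / s x)) \<partial>M)"
    using pos by (subst nn_integral_density) (simp_all add: ennreal_mult' less_imp_le)
  finally show ?thesis .
qed

section \<open>Gaussian mixtures\<close>

definition gauss_kernel :: "real \<Rightarrow> 'a::euclidean_space \<Rightarrow> real" where
  "gauss_kernel \<sigma> z = (\<Prod>b\<in>Basis. normal_density 0 \<sigma> (z \<bullet> b))"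

lemma gauss_kernel_eq:
  fixes z :: "'a::euclidean_space"
  assumes "\<sigma> > 0"
  shows "gauss_kernel \<sigma> z = exp (- (norm z)\<^sup>2 / (2 * \<sigma>\<^sup>2)) / sqrt (2 * pi * \<sigma>\<^sup>2) ^ DIM('a)"
proof -
  have "(norm z)\<^sup>2 = (\<Sum>b\<in>Basis. (z \<bullet> b)\<^sup>2)"
    unfolding power2_norm_eq_inner by (subst euclidean_inner) (simp add: power2_eq_square)
  then show ?thesis
    by (simp add: gauss_kernel_def normal_density_def prod_dividef exp_sum[symmetric] sum_negf
        sum_divide_distrib)
qed

lemma gauss_kernel_pos: "\<sigma> > 0 \<Longrightarrow> 0 < gauss_kernel \<sigma> z"
  by (simp add: gauss_kernel_def normal_density_pos prod_pos)

lemma gauss_kernel_nonneg[simp]: "0 \<le> gauss_kernel \<sigma> z"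
  by (simp add: gauss_kernel_def prod_nonneg)

lemma gauss_kernel_le:
  fixes z :: "'a::euclidean_space"
  assumes "\<sigma> > 0" shows "gauss_kernel \<sigma> z \<le> gauss_kernel \<sigma> (0::'a)"
  using assms by (simp add: gauss_kernel_eq divide_right_mono)

lemma gauss_kernel_measurable[measurable]: "gauss_kernel \<sigma> \<in> borel_measurable borel"
  unfolding gauss_kernel_def[abs_def] by measurable

lemma nn_integral_gauss_kernel:
  assumes "\<sigma> > 0"
  shows "(\<integral>\<^sup>+z. ennreal (gauss_kernel \<sigma> (z::'a::euclidean_space)) \<partial>lborel) = 1"
proof -
  interpret prob_space "density lborel (normal_density 0 \<sigma>)"
    using assms by (rule prob_space_normal_density)
  have "(\<integral>\<^sup>+z. ennreal (normal_density 0 \<sigma> z) \<partial>lborel) = 1"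
    using emeasure_space_1 by (simp add: emeasure_density)
  moreover have "(\<integral>\<^sup>+z. ennreal (gauss_kernel \<sigma> (z::'a)) \<partial>lborel)
      = (\<integral>\<^sup>+z. (\<Prod>b\<in>Basis. ennreal (normal_density 0 \<sigma> ((z::'a) \<bullet> b))) \<partial>lborel)"
    by (simp add: gauss_kernel_def prod_ennreal)
  moreover have "\<dots> = (\<Prod>b\<in>(Basis::'a set). \<integral>\<^sup>+z. ennreal (normal_density 0 \<sigma> z) \<partial>lborel)"
    by (rule nn_integral_lborel_prod) simp_all
  ultimately show ?thesis
    by simp
qed

lemma nn_integral_lborel_shift:
  fixes f :: "'a::euclidean_space \<Rightarrow> ennreal"
  assumes [measurable]: "f \<in> borel_measurable borel"
  shows "(\<integral>\<^sup>+y. f (y - c) \<partial>lborel) = (\<integral>\<^sup>+y. f y \<partial>lborel)"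
  by (subst lborel_distr_plus[of "- c", symmetric]) (simp add: nn_integral_distr)

lemma gaussian_eq_gauss_kernel: "gaussian \<sigma> = density lborel (\<lambda>z. ennreal (gauss_kernel \<sigma> z))"
  by (simp add: gaussian_def gauss_kernel_def)

definition mixture_density :: "real \<Rightarrow> 'a::euclidean_space measure \<Rightarrow> 'a \<Rightarrow> real" where
  "mixture_density \<sigma> P y = (\<integral>x. gauss_kernel \<sigma> (y - x) \<partial>P)"

lemma gauss_kernel_integrable:
  fixes P :: "'a::euclidean_space measure"
  assumes "prob_space P" and [measurable_cong]: "sets P = sets borel" and "\<sigma> > 0"
  shows "integrable P (\<lambda>x. gauss_kernel \<sigma> (y - x))"
proof -
  interpret prob_space P by fact
  show ?thesis
    by (rule integrable_const_bound[where B="gauss_kernel \<sigma> (0::'a)"])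
       (use gauss_kernel_le[OF assms(3)] in auto)
qed

lemma mixture_density_eq_nn_integral:
  fixes P :: "'a::euclidean_space measure"
  assumes "prob_space P" and "sets P = sets borel" and "\<sigma> > 0"
  shows "ennreal (mixture_density \<sigma> P y) = (\<integral>\<^sup>+x. ennreal (gauss_kernel \<sigma> (y - x)) \<partial>P)"
  unfolding mixture_density_def
  using gauss_kernel_integrable[OF assms] by (simp add: nn_integral_eq_integral)

lemma mixture_density_measurable[measurable (raw)]:
  fixes P :: "'a::euclidean_space measure"
  assumes "prob_space P" and [measurable_cong]: "sets P = sets borel"
  shows "mixture_density \<sigma> P \<in> borel_measurable borel"
proof -
  interpret prob_space P by fact
  show ?thesis
    unfolding mixture_density_def[abs_def] by measurable
qed

lemma mixture_density_pos:
  fixes P :: "'a::euclidean_space measure"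
  assumes "prob_space P" and [measurable_cong]: "sets P = sets borel" and "\<sigma> > 0"
  shows "0 < mixture_density \<sigma> P y"
proof -
  interpret prob_space P by fact
  have "mixture_density \<sigma> P y \<noteq> 0"
  proof
    assume "mixture_density \<sigma> P y = 0"
    then have "AE x in P. gauss_kernel \<sigma> (y - x) = 0"
      unfolding mixture_density_def using gauss_kernel_integrable[OF assms]
      by (subst (asm) integral_nonneg_eq_0_iff_AE) auto
    then have "AE x in P. False"
      by (simp add: less_imp_neq[OF gauss_kernel_pos[OF assms(3)], symmetric])
    then show False by simp
  qed
  moreover have "0 \<le> mixture_density \<sigma> P y"
    by (simp add: mixture_density_def)
  ultimately show ?thesis by simp
qed

lemma convolution_gaussian:
  fixes P :: "'a::ordered_euclidean_space measure"
  assumes "prob_space P" and [measurable_cong]: "sets P = sets borel" and "\<sigma> > 0"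
  shows "P \<star> gaussian \<sigma> = density lborel (\<lambda>y. ennreal (mixture_density \<sigma> P y))"
proof (rule measure_eqI)
  interpret prob_space P by fact
  interpret pair_sigma_finite P lborel ..
  note [measurable] = mixture_density_measurable[OF assms(1,2)]
  fix A assume "A \<in> sets (P \<star> gaussian \<sigma>)"
  then have [measurable]: "A \<in> sets borel" by simp
  have G: "finite_measure (gaussian \<sigma> :: 'a measure)"
    using nn_integral_gauss_kernel[OF assms(3), where 'a='a]
    by (intro finite_measureI) (simp add: gaussian_eq_gauss_kernel emeasure_density)
  have "emeasure (P \<star> gaussian \<sigma>) A = (\<integral>\<^sup>+x. \<integral>\<^sup>+y. indicator A (x + y) \<partial>gaussian \<sigma> \<partial>P)"
    using G by (intro convolution_emeasure')
      (auto simp: finite_measure_axioms assms(2) gaussian_eq_gauss_kernel)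
  also have "\<dots> = (\<integral>\<^sup>+x. \<integral>\<^sup>+y. ennreal (gauss_kernel \<sigma> y) * indicator A (x + y) \<partial>lborel \<partial>P)"
    by (simp add: gaussian_eq_gauss_kernel nn_integral_density)
  also have "\<dots> = (\<integral>\<^sup>+x. \<integral>\<^sup>+y. ennreal (gauss_kernel \<sigma> (y - x)) * indicator A y \<partial>lborel \<partial>P)"
  proof (rule nn_integral_cong)
    fix x
    show "(\<integral>\<^sup>+y. ennreal (gauss_kernel \<sigma> y) * indicator A (x + y) \<partial>lborel)
        = (\<integral>\<^sup>+y. ennreal (gauss_kernel \<sigma> (y - x)) * indicator A y \<partial>lborel)"
      using nn_integral_lborel_shift[of "\<lambda>y. ennreal (gauss_kernel \<sigma> y) * indicator A (x + y)" x]
      by simp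
  qed
  also have "\<dots> = (\<integral>\<^sup>+y. \<integral>\<^sup>+x. ennreal (gauss_kernel \<sigma> (y - x)) * indicator A y \<partial>P \<partial>lborel)"
    by (rule Fubini'[symmetric]) simp
  also have "\<dots> = (\<integral>\<^sup>+y. ennreal (mixture_density \<sigma> P y) * indicator A y \<partial>lborel)"
    by (simp add: nn_integral_multc mixture_density_eq_nn_integral[OF assms])
  finally show "emeasure (P \<star> gaussian \<sigma>) A
      = emeasure (density lborel (\<lambda>y. ennreal (mixture_density \<sigma> P y))) A"
    by (simp add: emeasure_density)
qed simp

lemma nn_integral_mixture_density:
  fixes P :: "'a::euclidean_space measure"
  assumes "prob_space P" and [measurable_cong]: "sets P = sets borel" and "\<sigma> > 0"
  shows "(\<integral>\<^sup>+y. ennreal (mixture_density \<sigma> P y) \<partial>lborel) = 1"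
proof -
  interpret prob_space P by fact
  interpret pair_sigma_finite P lborel ..
  have "(\<integral>\<^sup>+y. ennreal (mixture_density \<sigma> P y) \<partial>lborel)
      = (\<integral>\<^sup>+x. \<integral>\<^sup>+y. ennreal (gauss_kernel \<sigma> (y - x)) \<partial>lborel \<partial>P)"
    unfolding mixture_density_eq_nn_integral[OF assms] by (rule Fubini') simp
  also have "\<dots> = (\<integral>\<^sup>+x. 1 \<partial>P)"
    by (intro nn_integral_cong)
       (simp add: nn_integral_lborel_shift[where f="\<lambda>z. ennreal (gauss_kernel \<sigma> z)"]
          nn_integral_gauss_kernel[OF assms(3)])
  finally show ?thesis
    by (simp add: emeasure_space_1)
qed

lemma empirical_measure_prob_space:
  assumes "n \<ge> 1" shows "prob_space (empirical_measure n X)"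
  unfolding empirical_measure_def using assms
  by (intro prob_space.prob_space_distr prob_space_uniform_count_measure)
     (auto simp: measurable_def space_uniform_count_measure sets_uniform_count_measure lessThan_empty_iff)

lemma sets_empirical_measure[simp]: "sets (empirical_measure n X) = sets borel"
  by (simp add: empirical_measure_def)

lemma mixture_density_empirical_measure:
  "mixture_density \<sigma> (empirical_measure n X) y = (\<Sum>i<n. gauss_kernel \<sigma> (y - X i)) / real n"
proof -
  have "X \<in> measurable (uniform_count_measure {..<n}) borel"
    by (auto simp: measurable_def space_uniform_count_measure sets_uniform_count_measure)
  then show ?thesis
    by (simp add: mixture_density_def empirical_measure_def integral_distr integral_uniform_count_measure)
qed

section \<open>Moments of sums of i.i.d. variables\<close>

lemma iid_sum_integrable:
  fixes f :: "'a \<Rightarrow> real" and n :: nat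
  assumes "prob_space P" and [measurable]: "f \<in> borel_measurable P"
    and bound: "\<And>x. \<bar>f x\<bar> \<le> B"
  shows "integrable (\<Pi>\<^sub>M i\<in>{..<n}. P) (\<lambda>X. (\<Sum>i<n. f (X i)) ^ k)"
proof -
  interpret N: prob_space "\<Pi>\<^sub>M i\<in>{..<n}. P"
    by (rule prob_space_PiM[OF assms(1)])
  show ?thesis
  proof (rule N.integrable_const_bound[where B="(n * B) ^ k"])
    have "\<bar>\<Sum>i<n. f (X i)\<bar> \<le> n * B" for X
      using sum_bounded_above[of "{..<n}" "\<lambda>i. \<bar>f (X i)\<bar>" B] bound
      by (intro order_trans[OF sum_abs]) simp
    then show "AE X in \<Pi>\<^sub>M i\<in>{..<n}. P. norm ((\<Sum>i<n. f (X i)) ^ k) \<le> (n * B) ^ k"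
      by (simp add: power_abs power_mono)
  qed measurable
qed

text \<open>
  All cross terms contain a factor of mean zero.  This kills the mixed terms up to order three, but
  not at order four, where \<open>(f (X i))\<^sup>2 (f (X j))\<^sup>2\<close> survives.
\<close>

lemma iid_sum_moments:
  fixes f :: "'a \<Rightarrow> real" and n :: nat
  assumes "prob_space P" and [measurable]: "f \<in> borel_measurable P"
    and bound: "\<And>x. \<bar>f x\<bar> \<le> B" and zero: "(\<integral>x. f x \<partial>P) = 0"
  shows "(\<integral>X. (\<Sum>i<n. f (X i))\<^sup>2 \<partial>(\<Pi>\<^sub>M i\<in>{..<n}. P)) = n * (\<integral>x. (f x)\<^sup>2 \<partial>P)"
    and "(\<integral>X. (\<Sum>i<n. f (X i)) ^ 3 \<partial>(\<Pi>\<^sub>M i\<in>{..<n}. P)) = n * (\<integral>x. (f x) ^ 3 \<partial>P)"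
proof -
  interpret P: prob_space P by fact
  interpret PP: product_sigma_finite "\<lambda>_::nat. P" ..
  have PiM: "prob_space (\<Pi>\<^sub>M i\<in>{..<n}. P)" for n :: nat
    by (rule prob_space_PiM[OF assms(1)])
  note int = iid_sum_integrable[OF assms(1-2) bound]
  have int_f: "integrable P (\<lambda>x. f x ^ k)" for k :: nat
    using bound by (intro P.integrable_const_bound[where B="B ^ k"]) (simp_all add: power_abs power_mono)
  have step: "(\<integral>X. (\<Sum>i<Suc n. f (X i)) ^ k \<partial>(\<Pi>\<^sub>M i\<in>{..<Suc n}. P))
      = (\<integral>X. (\<integral>y. ((\<Sum>i<n. f (X i)) + f y) ^ k \<partial>P) \<partial>(\<Pi>\<^sub>M i\<in>{..<n}. P))" for n k :: nat
    using PP.product_integral_insert[of "{..<n}" n "\<lambda>X. (\<Sum>i<Suc n. f (X i)) ^ k"] int[of "Suc n" k]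
    by (simp add: lessThan_Suc add.commute)
  have "(\<integral>X. (\<Sum>i<n. f (X i)) \<partial>(\<Pi>\<^sub>M i\<in>{..<n}. P)) = 0
    \<and> (\<integral>X. (\<Sum>i<n. f (X i))\<^sup>2 \<partial>(\<Pi>\<^sub>M i\<in>{..<n}. P)) = n * (\<integral>x. (f x)\<^sup>2 \<partial>P)
    \<and> (\<integral>X. (\<Sum>i<n. f (X i)) ^ 3 \<partial>(\<Pi>\<^sub>M i\<in>{..<n}. P)) = n * (\<integral>x. (f x) ^ 3 \<partial>P)"
  proof (induction n)
    case 0
    then show ?case by simp
  next
    case (Suc n)
    interpret N: prob_space "\<Pi>\<^sub>M i\<in>{..<n}. P" by (rule PiM)
    note [simp] = int[of n 1, simplified] int[of n 2] int[of n 3]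
      int_f[of 1, simplified] int_f[of 2] int_f[of 3]
    have 1: "(\<integral>y. s + f y \<partial>P) = s" for s
      by (simp add: P.prob_space zero)
    have "(\<integral>y. (s + f y)\<^sup>2 \<partial>P) = (\<integral>y. s\<^sup>2 + ((2 * s) * f y + (f y)\<^sup>2) \<partial>P)" for s
      by (intro Bochner_Integration.integral_cong) (simp_all add: power2_eq_square algebra_simps)
    then have 2: "(\<integral>y. (s + f y)\<^sup>2 \<partial>P) = s\<^sup>2 + (\<integral>y. (f y)\<^sup>2 \<partial>P)" for s
      by (simp add: P.prob_space zero)
    have "(\<integral>y. (s + f y)^3 \<partial>P) = (\<integral>y. s^3 + ((3 * s\<^sup>2) * f y + ((3 * s) * (f y)\<^sup>2 + (f y)^3)) \<partial>P)" for s
      by (intro Bochner_Integration.integral_cong)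
         (simp_all add: power2_eq_square power3_eq_cube algebra_simps)
    then have 3: "(\<integral>y. (s + f y)^3 \<partial>P) = s^3 + (3 * (\<integral>y. (f y)\<^sup>2 \<partial>P) * s + (\<integral>y. (f y)^3 \<partial>P))" for s
      by (simp add: P.prob_space zero)
    have "(\<integral>X. (\<Sum>i<Suc n. f (X i)) \<partial>(\<Pi>\<^sub>M i\<in>{..<Suc n}. P)) = 0"
      using step[of n 1] Suc by (simp add: 1 del: sum.lessThan_Suc)
    moreover have "(\<integral>X. (\<Sum>i<Suc n. f (X i))\<^sup>2 \<partial>(\<Pi>\<^sub>M i\<in>{..<Suc n}. P))
        = n * (\<integral>x. (f x)\<^sup>2 \<partial>P) + (\<integral>x. (f x)\<^sup>2 \<partial>P)"
      using Suc by (simp only: step 2) (simp add: N.prob_space)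
    moreover have "(\<integral>X. (\<Sum>i<Suc n. f (X i)) ^ 3 \<partial>(\<Pi>\<^sub>M i\<in>{..<Suc n}. P))
        = n * (\<integral>x. (f x) ^ 3 \<partial>P) + (\<integral>x. (f x) ^ 3 \<partial>P)"
      using Suc by (simp only: step 3) (simp add: N.prob_space)
    ultimately show ?case
      by (simp add: algebra_simps del: sum.lessThan_Suc)
  qed
  then show "(\<integral>X. (\<Sum>i<n. f (X i))\<^sup>2 \<partial>(\<Pi>\<^sub>M i\<in>{..<n}. P)) = n * (\<integral>x. (f x)\<^sup>2 \<partial>P)"
    and "(\<integral>X. (\<Sum>i<n. f (X i)) ^ 3 \<partial>(\<Pi>\<^sub>M i\<in>{..<n}. P)) = n * (\<integral>x. (f x) ^ 3 \<partial>P)"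
    by auto
qed

section \<open>The expected divergence in terms of the kernel variance\<close>

definition pointwise_KL :: "real \<Rightarrow> 'a::euclidean_space measure \<Rightarrow> nat \<Rightarrow> 'a \<Rightarrow> ennreal" where
  "pointwise_KL \<sigma> P n y = (\<integral>\<^sup>+X. ennreal (mixture_density \<sigma> P y
      * kl_fun ((\<Sum>i<n. gauss_kernel \<sigma> (y - X i)) / real n / mixture_density \<sigma> P y))
      \<partial>(\<Pi>\<^sub>M i\<in>{..<n}. P))"

lemma pointwise_KL_measurable:
  fixes P :: "'a::euclidean_space measure"
  assumes "prob_space P" and [measurable_cong]: "sets P = sets borel"
  shows "pointwise_KL \<sigma> P n \<in> borel_measurable borel"
proof -
  interpret N: prob_space "\<Pi>\<^sub>M i\<in>{..<n}. P"
    by (rule prob_space_PiM[OF assms(1)])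
  note [measurable] = mixture_density_measurable[OF assms]
  show ?thesis
    unfolding pointwise_KL_def[abs_def] by measurable
qed

text \<open>
  By nonnegativity of \<^const>\<open>kl_fun\<close>, Tonelli moves the expectation over the sample inside, where
  for fixed \<open>y\<close> only an average of i.i.d. real variables is left.
\<close>

lemma expected_smoothed_KL_eq:
  fixes P :: "'a::ordered_euclidean_space measure" and n :: nat
  assumes P: "prob_space P" and s[measurable_cong]: "sets P = sets borel" and "\<sigma> > 0" and "n \<ge> 1"
  shows "expected_smoothed_KL \<sigma> P n = (\<integral>\<^sup>+y. pointwise_KL \<sigma> P n y \<partial>lborel)"
proof -
  interpret N: prob_space "\<Pi>\<^sub>M i\<in>{..<n}. P"
    by (rule prob_space_PiM[OF assms(1)])
  interpret pair_sigma_finite "\<Pi>\<^sub>M i\<in>{..<n}. P" lborel ..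
  note [measurable] = mixture_density_measurable[OF P s]
  have "expected_smoothed_KL \<sigma> P n = (\<integral>\<^sup>+X. \<integral>\<^sup>+y. ennreal (mixture_density \<sigma> P y
      * kl_fun ((\<Sum>i<n. gauss_kernel \<sigma> (y - X i)) / real n / mixture_density \<sigma> P y))
      \<partial>lborel \<partial>(\<Pi>\<^sub>M i\<in>{..<n}. P))"
    unfolding expected_smoothed_KL_def
  proof (rule nn_integral_cong)
    fix X :: "nat \<Rightarrow> 'a"
    let ?E = "empirical_measure n X"
    have E: "prob_space ?E"
      using \<open>n \<ge> 1\<close> by (rule empirical_measure_prob_space)
    have "KL_div (?E \<star> gaussian \<sigma>) (P \<star> gaussian \<sigma>)
        = (\<integral>\<^sup>+y. ennreal (mixture_density \<sigma> P y
            * kl_fun (mixture_density \<sigma> ?E y / mixture_density \<sigma> P y)) \<partial>lborel)"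
      unfolding convolution_gaussian[OF P s \<open>\<sigma> > 0\<close>]
        convolution_gaussian[OF E sets_empirical_measure \<open>\<sigma> > 0\<close>]
      using mixture_density_measurable[OF E] P s E assms(3)
      by (intro KL_div_densities) (simp_all add: mixture_density_pos nn_integral_mixture_density)
    then show "KL_div (?E \<star> gaussian \<sigma>) (P \<star> gaussian \<sigma>)
        = (\<integral>\<^sup>+y. ennreal (mixture_density \<sigma> P y
          * kl_fun ((\<Sum>i<n. gauss_kernel \<sigma> (y - X i)) / real n / mixture_density \<sigma> P y)) \<partial>lborel)"
      by (simp add: mixture_density_empirical_measure)
  qed
  also have "\<dots> = (\<integral>\<^sup>+y. pointwise_KL \<sigma> P n y \<partial>lborel)"
    unfolding pointwise_KL_def by (rule Fubini'[symmetric]) measurable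
  finally show ?thesis .
qed

definition mixture_second_moment :: "real \<Rightarrow> 'a::euclidean_space measure \<Rightarrow> 'a \<Rightarrow> real" where
  "mixture_second_moment \<sigma> P y = (\<integral>x. (gauss_kernel \<sigma> (y - x))\<^sup>2 \<partial>P)"

lemma gauss_kernel_square_integrable:
  fixes P :: "'a::euclidean_space measure"
  assumes "prob_space P" and [measurable_cong]: "sets P = sets borel" and "\<sigma> > 0"
  shows "integrable P (\<lambda>x. (gauss_kernel \<sigma> (y - x))\<^sup>2)"
proof -
  interpret prob_space P by fact
  show ?thesis
    by (rule integrable_const_bound[where B="(gauss_kernel \<sigma> (0::'a))\<^sup>2"])
       (use gauss_kernel_le[OF assms(3)] in \<open>auto intro!: power_mono\<close>)
qed

text \<open>
  The ratio of the empirical to the true mixture density at \<open>y\<close> is \<open>1 + W / n\<close>, where \<open>W\<close> is a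
  sum of \<open>n\<close> i.i.d. copies of the bounded centred variable \<open>Z y\<close>; \<open>V y\<close> is the mixture density
  times the variance of \<open>Z y\<close>.  So the second moment of \<open>W / n\<close> is of order \<open>1 / n\<close> and the
  third of order \<open>1 / n\<^sup>2\<close>.
\<close>

lemma pointwise_KL_bounds:
  fixes P :: "'a::euclidean_space measure" and n :: nat
  assumes P: "prob_space P" and s[measurable_cong]: "sets P = sets borel" and "\<sigma> > 0" and "n \<ge> 1"
  defines "Z \<equiv> \<lambda>y x. gauss_kernel \<sigma> (y - x) / mixture_density \<sigma> P y - 1"
  defines "V \<equiv> \<lambda>y. mixture_second_moment \<sigma> P y / mixture_density \<sigma> P y - mixture_density \<sigma> P y"
  shows "pointwise_KL \<sigma> P n y \<le> ennreal (V y / n)"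
    and "ennreal (V y / (2 * n) - mixture_density \<sigma> P y * (\<integral>x. Z y x ^ 3 \<partial>P) / (6 * n\<^sup>2))
      \<le> pointwise_KL \<sigma> P n y"
    and "0 \<le> V y"
proof -
  interpret prob_space P by fact
  let ?N = "\<Pi>\<^sub>M i\<in>{..<n}. P"
  define m where "m = mixture_density \<sigma> P y"
  have m: "m > 0"
    unfolding m_def using mixture_density_pos[OF P s \<open>\<sigma> > 0\<close>] .
  define W where "W X = (\<Sum>i<n. Z y (X i))" for X
  have Zm[measurable]: "Z y \<in> borel_measurable P"
    unfolding Z_def by measurable
  have bound: "\<bar>Z y x\<bar> \<le> gauss_kernel \<sigma> (0::'a) / m + 1" for x
  proof -
    have "0 \<le> gauss_kernel \<sigma> (y - x) / m" "gauss_kernel \<sigma> (y - x) / m \<le> gauss_kernel \<sigma> (0::'a) / m"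
      using m gauss_kernel_le[OF \<open>\<sigma> > 0\<close>] by (auto intro!: divide_right_mono)
    then show ?thesis
      unfolding Z_def m_def[symmetric] by linarith
  qed
  note gi = gauss_kernel_integrable[OF P s \<open>\<sigma> > 0\<close>, of y]
    and g2i = gauss_kernel_square_integrable[OF P s \<open>\<sigma> > 0\<close>, of y]
  have zero: "(\<integral>x. Z y x \<partial>P) = 0"
    using gi m by (simp add: Z_def prob_space flip: mixture_density_def m_def)
  have "(\<integral>x. (Z y x)\<^sup>2 \<partial>P) = (\<integral>x. (gauss_kernel \<sigma> (y - x))\<^sup>2 / m\<^sup>2 - 2 * gauss_kernel \<sigma> (y - x) / m + 1 \<partial>P)"
    by (intro Bochner_Integration.integral_cong)
       (simp_all add: Z_def m_def power2_eq_square algebra_simps)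
  also have "\<dots> = mixture_second_moment \<sigma> P y / m\<^sup>2 - 2 * m / m + 1"
    using gi g2i by (simp add: prob_space mixture_second_moment_def m_def flip: mixture_density_def)
  finally have V: "m * (\<integral>x. (Z y x)\<^sup>2 \<partial>P) = V y"
    using m by (simp add: V_def m_def[symmetric] field_simps power2_eq_square)
  then show "0 \<le> V y"
    using m by (simp flip: V)
  have mom: "(\<integral>X. (W X)\<^sup>2 \<partial>?N) = n * (\<integral>x. (Z y x)\<^sup>2 \<partial>P)" "(\<integral>X. (W X)^3 \<partial>?N) = n * (\<integral>x. (Z y x)^3 \<partial>P)"
    unfolding W_def using iid_sum_moments[OF P Zm bound zero, of n] by simp_all
  have Wi: "integrable ?N (\<lambda>X. (W X)^k)" for k
    unfolding W_def using iid_sum_integrable[OF P Zm bound] .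
  have Wm[measurable]: "W \<in> borel_measurable ?N"
    unfolding W_def by measurable
  have ratio: "(\<Sum>i<n. gauss_kernel \<sigma> (y - X i)) / real n / m = 1 + W X / n" for X
    using \<open>n \<ge> 1\<close> by (simp add: W_def Z_def m_def[symmetric] sum_subtractf field_simps flip: sum_divide_distrib)
  have ratio_pos: "1 + W X / n > 0" for X
  proof -
    have "(\<Sum>i<n. gauss_kernel \<sigma> (y - X i)) > 0"
      using \<open>n \<ge> 1\<close> gauss_kernel_pos[OF \<open>\<sigma> > 0\<close>] by (intro sum_pos) (auto simp: lessThan_empty_iff)
    then show ?thesis
      using \<open>n \<ge> 1\<close> m by (simp flip: ratio)
  qed
  have KL: "pointwise_KL \<sigma> P n y = (\<integral>\<^sup>+X. ennreal (m * kl_fun (1 + W X / n)) \<partial>?N)"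
    unfolding pointwise_KL_def m_def[symmetric] ratio ..
  have "pointwise_KL \<sigma> P n y \<le> (\<integral>\<^sup>+X. ennreal (m * (W X / n)\<^sup>2) \<partial>?N)"
    unfolding KL using kl_fun_le_square[OF ratio_pos] m
    by (intro nn_integral_mono ennreal_leI mult_left_mono) auto
  also have "\<dots> = ennreal (\<integral>X. m * (W X / n)\<^sup>2 \<partial>?N)"
    using Wi[of 2] m by (intro nn_integral_eq_integral) (simp_all add: power_divide)
  also have "(\<integral>X. m * (W X / n)\<^sup>2 \<partial>?N) = V y / n"
    using Wi[of 2] \<open>n \<ge> 1\<close> by (simp add: power_divide mom flip: V) (simp add: power2_eq_square)
  finally show "pointwise_KL \<sigma> P n y \<le> ennreal (V y / n)" .
  \<comment> \<open>The cubic lower bound \<open>L\<close> may be negative, so it is cut off at 0 before it is compared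
    with the nonnegative integral.\<close>
  define L where "L X = m * ((W X)\<^sup>2 / (2 * n\<^sup>2) - (W X)^3 / (6 * n ^ 3))" for X
  have Li: "integrable ?N L"
    unfolding L_def using Wi[of 2] Wi[of 3] by simp
  have "(\<integral>X. L X \<partial>?N) = m * (n * (\<integral>x. (Z y x)\<^sup>2 \<partial>P) / (2 * n\<^sup>2) - n * (\<integral>x. (Z y x)^3 \<partial>P) / (6 * n ^ 3))"
    unfolding L_def using Wi[of 2] Wi[of 3] by (simp add: mom)
  also have "\<dots> = V y / (2 * n) - m * (\<integral>x. (Z y x)^3 \<partial>P) / (6 * n\<^sup>2)"
    using \<open>n \<ge> 1\<close> by (simp add: field_simps power2_eq_square power3_eq_cube flip: V)
  finally have "ennreal (V y / (2 * n) - m * (\<integral>x. (Z y x)^3 \<partial>P) / (6 * n\<^sup>2)) = ennreal (\<integral>X. L X \<partial>?N)"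
    by simp
  also have "\<dots> \<le> ennreal (\<integral>X. max 0 (L X) \<partial>?N)"
    using Li by (intro ennreal_leI integral_mono) auto
  also have "\<dots> = (\<integral>\<^sup>+X. ennreal (max 0 (L X)) \<partial>?N)"
    using Li by (intro nn_integral_eq_integral[symmetric]) auto
  also have "\<dots> \<le> pointwise_KL \<sigma> P n y"
    unfolding KL
  proof (intro nn_integral_mono ennreal_leI)
    fix X
    have "L X = m * ((1 + W X / n - 1)\<^sup>2 / 2 - (1 + W X / n - 1)^3 / 6)"
      by (simp add: L_def power_divide)
    also have "\<dots> \<le> m * kl_fun (1 + W X / n)"
      using kl_fun_ge_cubic[OF ratio_pos] m by (intro mult_left_mono) auto
    finally show "max 0 (L X) \<le> m * kl_fun (1 + W X / n)"
      using kl_fun_nonneg[OF ratio_pos] m by simp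
  qed
  finally show "ennreal (V y / (2 * n) - mixture_density \<sigma> P y * (\<integral>x. Z y x ^ 3 \<partial>P) / (6 * n\<^sup>2))
      \<le> pointwise_KL \<sigma> P n y"
    unfolding m_def .
qed

lemma expected_smoothed_KL_le:
  fixes P :: "'a::ordered_euclidean_space measure" and n :: nat
  assumes P: "prob_space P" and s: "sets P = sets borel" and "\<sigma> > 0" and "n \<ge> 1"
  shows "expected_smoothed_KL \<sigma> P n
      \<le> (\<integral>\<^sup>+y. ennreal (mixture_second_moment \<sigma> P y / mixture_density \<sigma> P y / n) \<partial>lborel)"
  unfolding expected_smoothed_KL_eq[OF assms]
proof (rule nn_integral_mono)
  fix y
  show "pointwise_KL \<sigma> P n y \<le> ennreal (mixture_second_moment \<sigma> P y / mixture_density \<sigma> P y / n)"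
    using mixture_density_pos[OF P s \<open>\<sigma> > 0\<close>, of y]
    by (intro order_trans[OF pointwise_KL_bounds(1)[OF assms]] ennreal_leI divide_right_mono) auto
qed

lemma mixture_second_moment_measurable:
  fixes P :: "'a::euclidean_space measure"
  assumes "prob_space P" and [measurable_cong]: "sets P = sets borel"
  shows "mixture_second_moment \<sigma> P \<in> borel_measurable borel"
proof -
  interpret prob_space P by fact
  show ?thesis
    unfolding mixture_second_moment_def[abs_def] by measurable
qed

lemma Liminf_pointwise_KL:
  fixes P :: "'a::euclidean_space measure"
  assumes P: "prob_space P" and s: "sets P = sets borel" and "\<sigma> > 0"
  shows "ennreal ((mixture_second_moment \<sigma> P y / mixture_density \<sigma> P y - mixture_density \<sigma> P y) / 2)
      \<le> liminf (\<lambda>n. of_nat n * pointwise_KL \<sigma> P n y)"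
proof -
  define c where "c = mixture_density \<sigma> P y
    * (\<integral>x. (gauss_kernel \<sigma> (y - x) / mixture_density \<sigma> P y - 1) ^ 3 \<partial>P) / 6"
  define v where "v = mixture_second_moment \<sigma> P y / mixture_density \<sigma> P y - mixture_density \<sigma> P y"
  have "(\<lambda>n. c / real n) \<longlonglongrightarrow> 0"
    by (rule tendsto_divide_0[OF tendsto_const]) (rule filterlim_at_top_imp_at_infinity[OF filterlim_real_sequentially])
  then have "(\<lambda>n. ennreal (v / 2 - c / real n)) \<longlonglongrightarrow> ennreal (v / 2 - 0)"
    by (intro tendsto_ennrealI tendsto_diff tendsto_const)
  then have "ennreal (v / 2) = liminf (\<lambda>n. ennreal (v / 2 - c / real n))"
    by (intro lim_imp_Liminf[symmetric]) simp_all
  also have "\<dots> \<le> liminf (\<lambda>n. of_nat n * pointwise_KL \<sigma> P n y)"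
  proof (rule Liminf_mono)
    show "\<forall>\<^sub>F n in sequentially. ennreal (v / 2 - c / real n) \<le> of_nat n * pointwise_KL \<sigma> P n y"
      using eventually_ge_at_top[of 1]
    proof eventually_elim
      fix n :: nat assume n: "1 \<le> n"
      have "v / 2 - c / n = n * (v / (2 * n) - c / n\<^sup>2)"
        using n by (simp add: field_simps power2_eq_square)
      then have "ennreal (v / 2 - c / n) = of_nat n * ennreal (v / (2 * n) - c / n\<^sup>2)"
        by (simp add: ennreal_mult' ennreal_of_nat_eq_real_of_nat)
      also have "\<dots> \<le> of_nat n * pointwise_KL \<sigma> P n y"
        using pointwise_KL_bounds(2)[OF P s \<open>\<sigma> > 0\<close> n, of y]
        by (intro mult_left_mono) (simp_all add: v_def c_def)
      finally show "ennreal (v / 2 - c / real n) \<le> of_nat n * pointwise_KL \<sigma> P n y" .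
    qed
  qed
  finally show ?thesis
    unfolding v_def .
qed

text \<open>
  Fatou's lemma: the pointwise lower limits have infinite integral.  Subtracting the mixture density,
  whose integral is 1, from the integrand of the hypothesis does not make the integral finite.
\<close>

lemma expected_smoothed_KL_superlinear:
  fixes P :: "'a::ordered_euclidean_space measure"
  assumes P: "prob_space P" and s: "sets P = sets borel" and "\<sigma> > 0"
    and inf: "(\<integral>\<^sup>+y. ennreal (mixture_second_moment \<sigma> P y / mixture_density \<sigma> P y) \<partial>lborel) = \<infinity>"
  shows "(\<lambda>n. of_nat n * expected_smoothed_KL \<sigma> P n) \<longlonglongrightarrow> \<infinity>"
proof -
  note [measurable] = mixture_density_measurable[OF P s] mixture_second_moment_measurable[OF P s]
    pointwise_KL_measurable[OF P s]
  let ?m = "mixture_density \<sigma> P"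
  let ?V = "\<lambda>y. mixture_second_moment \<sigma> P y / ?m y - ?m y"
  have V: "0 \<le> ?V y" for y
    using pointwise_KL_bounds(3)[OF P s \<open>\<sigma> > 0\<close> order_refl] by simp
  have "\<infinity> = (\<integral>\<^sup>+y. ennreal (?V y) + ennreal (?m y) \<partial>lborel)"
    unfolding inf[symmetric] using V mixture_density_pos[OF P s \<open>\<sigma> > 0\<close>]
    by (intro nn_integral_cong) (simp add: less_imp_le flip: ennreal_plus)
  also have "\<dots> = (\<integral>\<^sup>+y. ennreal (?V y) \<partial>lborel) + 1"
    by (subst nn_integral_add) (simp_all add: nn_integral_mixture_density[OF P s \<open>\<sigma> > 0\<close>])
  finally have Vinf: "(\<integral>\<^sup>+y. ennreal (?V y) \<partial>lborel) = \<infinity>"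
    by (metis ennreal_add_eq_top ennreal_one_neq_top infinity_ennreal_def)
  have "\<infinity> = (\<integral>\<^sup>+y. ennreal (1/2) * ennreal (?V y) \<partial>lborel)"
    by (subst nn_integral_cmult) (simp_all add: Vinf ennreal_mult_top)
  also have "\<dots> = (\<integral>\<^sup>+y. ennreal (?V y / 2) \<partial>lborel)"
    by (intro nn_integral_cong, subst ennreal_mult'[symmetric]) (simp_all add: V)
  also have "\<dots> \<le> (\<integral>\<^sup>+y. liminf (\<lambda>n. of_nat n * pointwise_KL \<sigma> P n y) \<partial>lborel)"
    using Liminf_pointwise_KL[OF P s \<open>\<sigma> > 0\<close>] by (intro nn_integral_mono) simp
  also have "\<dots> \<le> liminf (\<lambda>n. \<integral>\<^sup>+y. of_nat n * pointwise_KL \<sigma> P n y \<partial>lborel)"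
    by (rule nn_integral_liminf) measurable
  also have "\<dots> = liminf (\<lambda>n. of_nat n * expected_smoothed_KL \<sigma> P n)"
  proof (rule Liminf_eq)
    show "\<forall>\<^sub>F n in sequentially. (\<integral>\<^sup>+y. of_nat n * pointwise_KL \<sigma> P n y \<partial>lborel)
        = of_nat n * expected_smoothed_KL \<sigma> P n"
      using eventually_ge_at_top[of 1]
      by eventually_elim
         (simp add: expected_smoothed_KL_eq[OF P s \<open>\<sigma> > 0\<close>] nn_integral_cmult)
  qed
  finally have "liminf (\<lambda>n. of_nat n * expected_smoothed_KL \<sigma> P n) = \<infinity>"
    by (simp add: top_unique)
  moreover have "limsup (\<lambda>n. of_nat n * expected_smoothed_KL \<sigma> P n) = \<infinity>"
    using calculation Liminf_le_Limsup[of sequentially "\<lambda>n. of_nat n * expected_smoothed_KL \<sigma> P n"]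
    by (simp add: top_unique)
  ultimately show ?thesis
    by (intro Liminf_eq_Limsup) simp_all
qed

section \<open>The parametric rate below the noise level\<close>

lemma nn_integral_exp_neg_norm_square:
  fixes c :: "'a::euclidean_space"
  assumes "a > 0"
  shows "(\<integral>\<^sup>+y. ennreal (exp (- a * (norm (y - c))\<^sup>2)) \<partial>lborel) = ennreal (sqrt (pi / a) ^ DIM('a))"
proof -
  define \<tau> where "\<tau> = sqrt (1 / (2 * a))"
  have \<tau>: "\<tau> > 0" "\<tau>\<^sup>2 = 1 / (2 * a)"
    using assms by (simp_all add: \<tau>_def)
  have "2 * pi * \<tau>\<^sup>2 = pi / a"
    by (simp add: \<tau>)
  then have *: "exp (- a * (norm z)\<^sup>2) = sqrt (pi / a) ^ DIM('a) * gauss_kernel \<tau> z" for z :: 'a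
    using assms by (simp add: gauss_kernel_eq[OF \<tau>(1)]) (simp add: \<tau>)
  have "(\<integral>\<^sup>+y. ennreal (exp (- a * (norm (y - c))\<^sup>2)) \<partial>lborel)
      = (\<integral>\<^sup>+z. ennreal (exp (- a * (norm (z::'a))\<^sup>2)) \<partial>lborel)"
    by (rule nn_integral_lborel_shift[where f="\<lambda>z. ennreal (exp (- a * (norm z)\<^sup>2))"]) simp
  also have "\<dots> = (\<integral>\<^sup>+z. ennreal (sqrt (pi / a) ^ DIM('a)) * ennreal (gauss_kernel \<tau> (z::'a)) \<partial>lborel)"
    unfolding * using assms by (simp add: ennreal_mult')
  also have "\<dots> = ennreal (sqrt (pi / a) ^ DIM('a))"
    by (simp add: nn_integral_cmult nn_integral_gauss_kernel[OF \<tau>(1)])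
  finally show ?thesis .
qed

lemma subgaussian_exp_moment:
  assumes "subgaussian K P"
  shows "integrable P (\<lambda>x. exp (l \<bullet> (x - (\<integral>y. y \<partial>P))))"
    and "(\<integral>x. exp (l \<bullet> (x - (\<integral>y. y \<partial>P))) \<partial>P) \<le> exp (1/2 * K\<^sup>2 * (norm l)\<^sup>2)"
proof -
  have [measurable_cong]: "sets P = sets borel"
    using assms by (simp add: subgaussian_def)
  have le: "(\<integral>\<^sup>+x. ennreal (exp (l \<bullet> (x - (\<integral>y. y \<partial>P)))) \<partial>P) \<le> ennreal (exp (1/2 * K\<^sup>2 * (norm l)\<^sup>2))"
    using assms by (simp add: subgaussian_def)
  show int: "integrable P (\<lambda>x. exp (l \<bullet> (x - (\<integral>y. y \<partial>P))))"
    using le by (intro integrableI_nonneg) (auto intro: le_less_trans)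
  then show "(\<integral>x. exp (l \<bullet> (x - (\<integral>y. y \<partial>P))) \<partial>P) \<le> exp (1/2 * K\<^sup>2 * (norm l)\<^sup>2)"
    using le by (simp add: nn_integral_eq_integral)
qed

lemma square_le_exp_plus_exp: "t\<^sup>2 \<le> 2 * (exp t + exp (- t))" for t :: real
proof -
  have *: "u\<^sup>2 \<le> 2 * (exp u + exp (- u))" if "u \<ge> 0" for u :: real
    using exp_lower_Taylor_quadratic[OF that] exp_ge_add_one_self[of "- u"] by simp
  show ?thesis
    using *[of t] *[of "- t"] by (cases "t \<ge> 0") (simp_all add: add.commute)
qed

lemma subgaussian_second_moment:
  fixes P :: "'a::euclidean_space measure"
  assumes "subgaussian K P"
  defines "m \<equiv> \<integral>y. y \<partial>P"
  shows "integrable P (\<lambda>x. (norm (x - m))\<^sup>2)"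
    and "(\<integral>x. (norm (x - m))\<^sup>2 \<partial>P) \<le> DIM('a) * (4 * exp (K\<^sup>2 / 2))"
proof -
  have [measurable_cong]: "sets P = sets borel"
    using assms by (simp add: subgaussian_def)
  define H where "H x = (\<Sum>b\<in>(Basis::'a set). 2 * (exp (b \<bullet> (x - m)) + exp (- b \<bullet> (x - m))))" for x
  have le: "(norm (x - m))\<^sup>2 \<le> H x" for x
  proof -
    have "(norm (x - m))\<^sup>2 = (\<Sum>b\<in>Basis. (b \<bullet> (x - m))\<^sup>2)"
      unfolding power2_norm_eq_inner
      by (subst euclidean_inner) (simp add: power2_eq_square inner_commute)
    also have "\<dots> \<le> H x"
      unfolding H_def inner_minus_left by (intro sum_mono square_le_exp_plus_exp)
    finally show ?thesis .
  qed
  note E = subgaussian_exp_moment[OF assms(1), folded m_def]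
  have H: "integrable P H"
    unfolding H_def using E(1) by (intro Bochner_Integration.integrable_sum integrable_mult_right Bochner_Integration.integrable_add)
  then show int: "integrable P (\<lambda>x. (norm (x - m))\<^sup>2)"
    by (rule Bochner_Integration.integrable_bound) (auto intro!: AE_I2 order_trans[OF le abs_ge_self])
  have "(\<integral>x. (norm (x - m))\<^sup>2 \<partial>P) \<le> (\<integral>x. H x \<partial>P)"
    using int H le by (rule integral_mono)
  also have "\<dots> = (\<Sum>b\<in>(Basis::'a set). 2 * ((\<integral>x. exp (b \<bullet> (x - m)) \<partial>P) + (\<integral>x. exp (- b \<bullet> (x - m)) \<partial>P)))"
    unfolding H_def using E(1)
    by (simp only: Bochner_Integration.integral_sum integral_mult_right_zero Bochner_Integration.integral_add
        integrable_mult_right Bochner_Integration.integrable_add)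
  also have "\<dots> \<le> (\<Sum>b\<in>(Basis::'a set). 4 * exp (K\<^sup>2 / 2))"
  proof (rule sum_mono)
    fix b :: 'a assume "b \<in> Basis"
    then show "2 * ((\<integral>x. exp (b \<bullet> (x - m)) \<partial>P) + (\<integral>x. exp (- b \<bullet> (x - m)) \<partial>P)) \<le> 4 * exp (K\<^sup>2 / 2)"
      using E(2)[of b] E(2)[of "- b"] by simp
  qed
  finally show "(\<integral>x. (norm (x - m))\<^sup>2 \<partial>P) \<le> DIM('a) * (4 * exp (K\<^sup>2 / 2))"
    by simp
qed

text \<open>
  Jensen's inequality for the exponential, in the form of the tangent line at \<open>a\<close>: the mixture
  density decays no faster than a single Gaussian at the mean, and the constant depends on
  \<open>P\<close> only through a bound for its variance.
\<close>

lemma mixture_density_ge: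
  fixes P :: "'a::euclidean_space measure"
  assumes P: "prob_space P" and s[measurable_cong]: "sets P = sets borel" and "\<sigma> > 0"
    and mean: "integrable P (\<lambda>x. x)"
  defines "m \<equiv> \<integral>x. x \<partial>P"
  assumes var: "integrable P (\<lambda>x. (norm (x - m))\<^sup>2)" "(\<integral>x. (norm (x - m))\<^sup>2 \<partial>P) \<le> M"
  shows "gauss_kernel \<sigma> (0::'a) * exp (- (norm (y - m))\<^sup>2 / (2 * \<sigma>\<^sup>2)) * exp (- M / (2 * \<sigma>\<^sup>2))
      \<le> mixture_density \<sigma> P y"
proof -
  interpret prob_space P by fact
  define z where "z = y - m"
  define U where "U x = (z \<bullet> (x - m)) / \<sigma>\<^sup>2 - (norm (x - m))\<^sup>2 / (2 * \<sigma>\<^sup>2)" for x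
  define a where "a = - M / (2 * \<sigma>\<^sup>2)"
  define A where "A = gauss_kernel \<sigma> (0::'a) * exp (- (norm z)\<^sup>2 / (2 * \<sigma>\<^sup>2))"
  have A: "A > 0"
    unfolding A_def by (intro mult_pos_pos gauss_kernel_pos \<open>\<sigma> > 0\<close>) simp
  have lin: "integrable P (\<lambda>x. z \<bullet> (x - m))" "(\<integral>x. z \<bullet> (x - m) \<partial>P) = 0"
    using mean by (simp_all add: inner_diff_right prob_space m_def)
  have U: "integrable P U" "a \<le> (\<integral>x. U x \<partial>P)"
    unfolding U_def a_def using lin var \<open>\<sigma> > 0\<close> by (simp_all add: divide_right_mono)
  have sq: "(norm (u - w))\<^sup>2 = (norm u)\<^sup>2 - 2 * (u \<bullet> w) + (norm w)\<^sup>2" for u w :: 'a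
    by (simp add: power2_norm_eq_inner inner_diff_left inner_diff_right inner_commute)
  have "gauss_kernel \<sigma> (y - x) = A * exp (U x)" for x
  proof -
    have "y - x = z - (x - m)"
      by (simp add: z_def)
    then have "(norm (y - x))\<^sup>2 = (norm z)\<^sup>2 - 2 * (z \<bullet> (x - m)) + (norm (x - m))\<^sup>2"
      using sq[of z "x - m"] by (simp only:)
    then have "- (norm (y - x))\<^sup>2 / (2 * \<sigma>\<^sup>2) = - (norm z)\<^sup>2 / (2 * \<sigma>\<^sup>2) + U x"
      unfolding U_def by (simp add: add_divide_distrib diff_divide_distrib)
    then show ?thesis
      unfolding A_def gauss_kernel_eq[OF \<open>\<sigma> > 0\<close>] by (simp only: exp_add) simp
  qed
  moreover have "A * (exp a * (1 + U x - a)) \<le> A * exp (U x)" for x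
  proof -
    have "exp a * (1 + (U x - a)) \<le> exp a * exp (U x - a)"
      by (intro mult_left_mono) simp_all
    then show ?thesis
      using A by (intro mult_left_mono) (simp_all add: algebra_simps flip: exp_add)
  qed
  ultimately have "(\<integral>x. A * (exp a * (1 + U x - a)) \<partial>P) \<le> mixture_density \<sigma> P y"
    unfolding mixture_density_def using U gauss_kernel_integrable[OF P s \<open>\<sigma> > 0\<close>, of y]
    by (intro integral_mono) simp_all
  moreover have "(\<integral>x. A * (exp a * (1 + U x - a)) \<partial>P) = A * (exp a * (1 + (\<integral>x. U x \<partial>P) - a))"
    using U by (simp add: prob_space)
  moreover have "A * (exp a * 1) \<le> A * (exp a * (1 + (\<integral>x. U x \<partial>P) - a))"
    using A U by (intro mult_left_mono) simp_all
  ultimately have "A * exp a \<le> mixture_density \<sigma> P y"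
    by linarith
  then show ?thesis
    by (simp add: A_def a_def z_def)
qed

text \<open>
  Points \<open>x\<close> at distance at least \<open>\<epsilon> |y - m|\<close> from \<open>y\<close> contribute little, because there one of the
  two kernel factors is small and the other one averages to the mixture density.  The other
  points lie in a half space far from the mean, whose probability is small by Chernoff's bound.
\<close>

lemma mixture_second_moment_le:
  fixes P :: "'a::euclidean_space measure"
  assumes P: "subgaussian K P" and "K > 0" "\<sigma> > 0" "0 \<le> \<epsilon>" "\<epsilon> \<le> 1"
  defines "m \<equiv> \<integral>x. x \<partial>P"
  shows "mixture_second_moment \<sigma> P y
    \<le> gauss_kernel \<sigma> (0::'a) * exp (- \<epsilon>\<^sup>2 / (2 * \<sigma>\<^sup>2) * (norm (y - m))\<^sup>2) * mixture_density \<sigma> P y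
      + (gauss_kernel \<sigma> (0::'a))\<^sup>2 * exp (- (1 - \<epsilon>)\<^sup>2 / (2 * K\<^sup>2) * (norm (y - m))\<^sup>2)"
proof -
  have ps: "prob_space P" and s[measurable_cong]: "sets P = sets borel"
    using P by (simp_all add: subgaussian_def)
  define g0 where "g0 = gauss_kernel \<sigma> (0::'a)"
  define z where "z = y - m"
  \<comment> \<open>the optimal Chernoff parameter for the half space \<open>z \<bullet> (x - m) \<ge> (1 - \<epsilon>) |z|\<^sup>2\<close>\<close>
  define \<kappa> where "\<kappa> = (1 - \<epsilon>) / K\<^sup>2"
  define A where "A = exp (- \<epsilon>\<^sup>2 / (2 * \<sigma>\<^sup>2) * (norm z)\<^sup>2)"
  define D where "D = exp (- \<kappa> * ((1 - \<epsilon>) * (norm z)\<^sup>2))"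
  have g0: "g0 > 0" unfolding g0_def using gauss_kernel_pos[OF \<open>\<sigma> > 0\<close>] .
  have \<kappa>: "\<kappa> \<ge> 0"
    using assms by (simp add: \<kappa>_def)
  have g_le: "gauss_kernel \<sigma> (y - x) \<le> g0" for x
    unfolding g0_def by (rule gauss_kernel_le[OF \<open>\<sigma> > 0\<close>])
  have pw: "(gauss_kernel \<sigma> (y - x))\<^sup>2 \<le> g0 * A * gauss_kernel \<sigma> (y - x) + g0\<^sup>2 * D * exp ((\<kappa> *\<^sub>R z) \<bullet> (x - m))"
    (is "_ \<le> ?far + ?near") for x
  proof (cases "z \<bullet> (x - m) < (1 - \<epsilon>) * (norm z)\<^sup>2")
    case True
    have "\<epsilon> * norm z \<le> norm (y - x)"
    proof (cases "z = 0")
      case False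
      have "\<epsilon> * (norm z)\<^sup>2 \<le> (norm z)\<^sup>2 - z \<bullet> (x - m)"
        using True by (simp add: algebra_simps)
      also have "\<dots> = z \<bullet> (y - x)"
        by (simp add: z_def power2_norm_eq_inner inner_diff algebra_simps)
      also have "\<dots> \<le> norm z * norm (y - x)"
        by (rule norm_cauchy_schwarz)
      finally have "norm z * (\<epsilon> * norm z) \<le> norm z * norm (y - x)"
        by (simp add: power2_eq_square algebra_simps)
      then show ?thesis
        using False by simp
    qed simp
    then have "(\<epsilon> * norm z)\<^sup>2 \<le> (norm (y - x))\<^sup>2"
      using \<open>0 \<le> \<epsilon>\<close> by (intro power_mono) simp_all
    then have "- (norm (y - x))\<^sup>2 / (2 * \<sigma>\<^sup>2) \<le> - (\<epsilon>\<^sup>2 * (norm z)\<^sup>2) / (2 * \<sigma>\<^sup>2)"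
      by (intro divide_right_mono) (simp_all add: power_mult_distrib)
    then have "gauss_kernel \<sigma> (y - x) \<le> g0 * A"
      unfolding g0_def A_def using \<open>\<sigma> > 0\<close> by (simp add: gauss_kernel_eq divide_right_mono)
    then have "(gauss_kernel \<sigma> (y - x))\<^sup>2 \<le> ?far"
      unfolding power2_eq_square by (intro mult_right_mono) simp_all
    also have "\<dots> \<le> ?far + ?near"
      by (simp add: D_def)
    finally show ?thesis .
  next
    case False
    then have "\<kappa> * ((1 - \<epsilon>) * (norm z)\<^sup>2) \<le> \<kappa> * (z \<bullet> (x - m))"
      using \<kappa> by (intro mult_left_mono) simp_all
    then have "1 \<le> D * exp ((\<kappa> *\<^sub>R z) \<bullet> (x - m))"
      by (simp add: D_def flip: exp_add)
    then have "g0\<^sup>2 * 1 \<le> ?near"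
      unfolding mult.assoc by (intro mult_left_mono) simp_all
    moreover have "(gauss_kernel \<sigma> (y - x))\<^sup>2 \<le> g0\<^sup>2"
      using g_le by (intro power_mono) simp_all
    moreover have "0 \<le> ?far"
      using g0 by (simp add: A_def)
    ultimately show ?thesis by linarith
  qed
  note gi = gauss_kernel_integrable[OF ps s \<open>\<sigma> > 0\<close>, of y]
  note E = subgaussian_exp_moment[OF P, folded m_def, of "\<kappa> *\<^sub>R z"]
  have "mixture_second_moment \<sigma> P y
      \<le> (\<integral>x. g0 * A * gauss_kernel \<sigma> (y - x) + g0\<^sup>2 * D * exp ((\<kappa> *\<^sub>R z) \<bullet> (x - m)) \<partial>P)"
    unfolding mixture_second_moment_def
    using pw gi E(1) gauss_kernel_square_integrable[OF ps s \<open>\<sigma> > 0\<close>]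
    by (intro integral_mono Bochner_Integration.integrable_add integrable_mult_right)
  also have "\<dots> = g0 * A * mixture_density \<sigma> P y + g0\<^sup>2 * D * (\<integral>x. exp ((\<kappa> *\<^sub>R z) \<bullet> (x - m)) \<partial>P)"
    using gi E(1)
    by (subst Bochner_Integration.integral_add)
       (simp_all only: integrable_mult_right integral_mult_right_zero mixture_density_def)
  also have "\<dots> \<le> g0 * A * mixture_density \<sigma> P y + g0\<^sup>2 * D * exp (1/2 * K\<^sup>2 * (norm (\<kappa> *\<^sub>R z))\<^sup>2)"
    using E(2) by (intro add_left_mono mult_left_mono) (simp_all add: D_def)
  also have "g0\<^sup>2 * D * exp (1/2 * K\<^sup>2 * (norm (\<kappa> *\<^sub>R z))\<^sup>2) = g0\<^sup>2 * exp (- (1 - \<epsilon>)\<^sup>2 / (2 * K\<^sup>2) * (norm z)\<^sup>2)"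
  proof -
    have "- \<kappa> * ((1 - \<epsilon>) * (norm z)\<^sup>2) + 1/2 * K\<^sup>2 * (norm (\<kappa> *\<^sub>R z))\<^sup>2
        = - (1 - \<epsilon>)\<^sup>2 / (2 * K\<^sup>2) * (norm z)\<^sup>2"
    proof -
      have "K\<^sup>2 * \<kappa> = 1 - \<epsilon>"
        using \<open>K > 0\<close> by (simp add: \<kappa>_def)
      then have 1: "1/2 * K\<^sup>2 * (norm (\<kappa> *\<^sub>R z))\<^sup>2 = 1/2 * (1 - \<epsilon>) * (\<kappa> * (norm z)\<^sup>2)"
        by (simp add: power_mult_distrib power2_eq_square[of \<kappa>] flip: \<open>K\<^sup>2 * \<kappa> = 1 - \<epsilon>\<close>)
      have 2: "- (1 - \<epsilon>)\<^sup>2 / (2 * K\<^sup>2) = - (1/2 * (1 - \<epsilon>) * \<kappa>)"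
        by (simp add: \<kappa>_def power2_eq_square)
      show ?thesis
        unfolding 1 2 by (simp add: algebra_simps)
    qed
    then show ?thesis
      unfolding D_def mult.assoc exp_add[symmetric] by simp
  qed
  finally show ?thesis
    unfolding g0_def A_def z_def .
qed

text \<open>
  Dividing the bound for the second moment by the mixture density leaves two Gaussians.  The second
  one is integrable as soon as \<open>(1 - \<epsilon>)\<^sup>2 / K\<^sup>2 > 1 / \<sigma>\<^sup>2\<close>, and such an \<open>\<epsilon> > 0\<close> exists
  because \<open>K < \<sigma>\<close>.
\<close>

theorem smoothed_KL_parametric_rate:
  fixes K \<sigma> :: real
  assumes "0 < K" "K < \<sigma>"
  shows "\<exists>C::real. \<forall>P :: 'a::ordered_euclidean_space measure. subgaussian K P \<longrightarrow>
           (\<forall>n::nat. n \<ge> 1 \<longrightarrow> expected_smoothed_KL \<sigma> P n \<le> ennreal (C / real n))"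
proof -
  have "\<sigma> > 0" using assms by simp
  define \<epsilon> where "\<epsilon> = (1 - K / \<sigma>) / 2"
  have "K / \<sigma> < 1" "0 < K / \<sigma>"
    using assms by simp_all
  then have \<epsilon>: "0 < \<epsilon>" "\<epsilon> \<le> 1"
    by (simp_all add: \<epsilon>_def)
  have \<epsilon>': "K / \<sigma> < 1 - \<epsilon>"
  proof -
    have "q < 1 - (1 - q) / 2" if "q < 1" for q :: real
      using that by (simp add: field_simps)
    then show ?thesis
      using \<open>K / \<sigma> < 1\<close> by (simp only: \<epsilon>_def)
  qed
  define M where "M = DIM('a) * (4 * exp (K\<^sup>2 / 2))"
  define g0 where "g0 = gauss_kernel \<sigma> (0::'a)"
  define a where "a = \<epsilon>\<^sup>2 / (2 * \<sigma>\<^sup>2)"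
  define b where "b = (1 - \<epsilon>)\<^sup>2 / (2 * K\<^sup>2) - 1 / (2 * \<sigma>\<^sup>2)"
  define c where "c = g0 * exp (M / (2 * \<sigma>\<^sup>2))"
  have g0: "g0 > 0" unfolding g0_def using gauss_kernel_pos[OF \<open>\<sigma> > 0\<close>] .
  have c: "c \<ge> 0" using g0 by (simp add: c_def)
  have a: "a > 0"
    using \<epsilon> \<open>\<sigma> > 0\<close> by (simp add: a_def)
  have "(K / \<sigma>)\<^sup>2 < (1 - \<epsilon>)\<^sup>2"
    using \<epsilon>' \<open>0 < K / \<sigma>\<close> by (intro power_strict_mono) simp_all
  then have b: "b > 0"
    using assms \<open>\<sigma> > 0\<close> by (simp add: b_def power_divide field_simps)
  define C where "C = g0 * sqrt (pi / a) ^ DIM('a) + c * sqrt (pi / b) ^ DIM('a)"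
  have "expected_smoothed_KL \<sigma> P n \<le> ennreal (C / real n)"
    if P: "subgaussian K P" and n: "n \<ge> 1" for P :: "'a measure" and n :: nat
  proof -
    have ps: "prob_space P" and s: "sets P = sets borel" and mean: "integrable P (\<lambda>x. x)"
      using P by (simp_all add: subgaussian_def)
    define m where "m = (\<integral>x. x \<partial>P)"
    have ratio: "mixture_second_moment \<sigma> P y / mixture_density \<sigma> P y
        \<le> g0 * exp (- a * (norm (y - m))\<^sup>2) + c * exp (- b * (norm (y - m))\<^sup>2)" for y
    proof -
      define R where "R = (norm (y - m))\<^sup>2"
      define d where "d = mixture_density \<sigma> P y"
      have d: "d > 0"
        unfolding d_def by (rule mixture_density_pos[OF ps s \<open>\<sigma> > 0\<close>])
      have d_ge: "g0 * exp (- R / (2 * \<sigma>\<^sup>2)) * exp (- M / (2 * \<sigma>\<^sup>2)) \<le> d"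
        unfolding g0_def R_def m_def d_def M_def
        by (intro mixture_density_ge ps s \<open>\<sigma> > 0\<close> mean subgaussian_second_moment[OF P])
      have "mixture_second_moment \<sigma> P y
          \<le> g0 * exp (- a * R) * d + g0\<^sup>2 * exp (- (1 - \<epsilon>)\<^sup>2 / (2 * K\<^sup>2) * R)"
        unfolding g0_def R_def m_def d_def a_def
        using mixture_second_moment_le[OF P \<open>0 < K\<close> \<open>\<sigma> > 0\<close> less_imp_le[OF \<epsilon>(1)] \<epsilon>(2), of y] by simp
      also have "g0\<^sup>2 * exp (- (1 - \<epsilon>)\<^sup>2 / (2 * K\<^sup>2) * R)
          = c * exp (- b * R) * (g0 * exp (- R / (2 * \<sigma>\<^sup>2)) * exp (- M / (2 * \<sigma>\<^sup>2)))"
      proof -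
        have "- (1 - \<epsilon>)\<^sup>2 / (2 * K\<^sup>2) * R = M / (2 * \<sigma>\<^sup>2) + (- b * R + (- R / (2 * \<sigma>\<^sup>2) + - M / (2 * \<sigma>\<^sup>2)))"
          by (simp add: b_def algebra_simps)
        then have "exp (- (1 - \<epsilon>)\<^sup>2 / (2 * K\<^sup>2) * R)
            = exp (M / (2 * \<sigma>\<^sup>2)) * (exp (- b * R) * (exp (- R / (2 * \<sigma>\<^sup>2)) * exp (- M / (2 * \<sigma>\<^sup>2))))"
          by (simp only: exp_add)
        then show ?thesis
          by (simp add: c_def power2_eq_square)
      qed
      also have "\<dots> \<le> c * exp (- b * R) * d"
        using d_ge c by (intro mult_left_mono) simp_all
      finally have "mixture_second_moment \<sigma> P y \<le> (g0 * exp (- a * R) + c * exp (- b * R)) * d"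
        by (simp add: algebra_simps)
      then show ?thesis
        using d by (simp add: R_def d_def pos_divide_le_eq)
    qed
    have "expected_smoothed_KL \<sigma> P n
        \<le> (\<integral>\<^sup>+y. ennreal (mixture_second_moment \<sigma> P y / mixture_density \<sigma> P y / n) \<partial>lborel)"
      by (rule expected_smoothed_KL_le[OF ps s \<open>\<sigma> > 0\<close> n])
    also have "\<dots> \<le> (\<integral>\<^sup>+y. ennreal (g0 / n) * ennreal (exp (- a * (norm (y - m))\<^sup>2))
        + ennreal (c / n) * ennreal (exp (- b * (norm (y - m))\<^sup>2)) \<partial>lborel)"
    proof (rule nn_integral_mono)
      fix y
      have "ennreal (mixture_second_moment \<sigma> P y / mixture_density \<sigma> P y / n)
          \<le> ennreal ((g0 * exp (- a * (norm (y - m))\<^sup>2) + c * exp (- b * (norm (y - m))\<^sup>2)) / n)"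
        using ratio by (intro ennreal_leI divide_right_mono) simp_all
      also have "\<dots> = ennreal (g0 / n) * ennreal (exp (- a * (norm (y - m))\<^sup>2))
          + ennreal (c / n) * ennreal (exp (- b * (norm (y - m))\<^sup>2))"
        using g0 c by (simp add: add_divide_distrib flip: ennreal_mult' ennreal_plus)
      finally show "ennreal (mixture_second_moment \<sigma> P y / mixture_density \<sigma> P y / n) \<le> \<dots>" .
    qed
    also have "\<dots> = ennreal (g0 / n) * ennreal (sqrt (pi / a) ^ DIM('a)) + ennreal (c / n) * ennreal (sqrt (pi / b) ^ DIM('a))"
      by (simp add: nn_integral_add nn_integral_cmult
          nn_integral_exp_neg_norm_square[OF a, simplified] nn_integral_exp_neg_norm_square[OF b, simplified])
    also have "\<dots> = ennreal (C / n)"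
      using g0 c a b by (simp add: C_def add_divide_distrib flip: ennreal_mult' ennreal_plus)
    finally show ?thesis .
  qed
  then show ?thesis by blast
qed

section \<open>Symmetric discrete distributions\<close>

lemma exp_add_exp_minus_le:
  fixes t :: real
  shows "exp t + exp (- t) - 2 \<le> t\<^sup>2 * exp \<bar>t\<bar>"
proof -
  define u where "u = \<bar>t\<bar>"
  have u: "u \<ge> 0" "t\<^sup>2 = u\<^sup>2" "exp t + exp (- t) = exp u + exp (- u)"
    by (auto simp: u_def abs_if)
  have "1 - u \<le> exp (- u)"
    using exp_ge_add_one_self[of "- u"] by simp
  then have "exp u * (1 - u) \<le> exp u * exp (- u)"
    by (intro mult_left_mono) simp_all
  then have le: "exp u - 1 \<le> u * exp u"
    by (simp add: algebra_simps flip: exp_add)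
  have "exp u + exp (- u) - 2 = exp (- u) * (exp u - 1)\<^sup>2"
    by (simp add: power2_eq_square algebra_simps flip: exp_add)
  also have "\<dots> \<le> exp (- u) * (u * exp u)\<^sup>2"
    using u le by (intro mult_left_mono power_mono) simp_all
  also have "\<dots> = u\<^sup>2 * exp u"
    by (simp add: power2_eq_square algebra_simps flip: exp_add)
  finally show ?thesis
    by (simp add: u u_def[symmetric])
qed

text \<open>
  The contribution of a pair of atoms \<open>\<plusminus>x\<close> to the moment generating function, compared with the
  excess \<open>exp a - 1\<close> of the subgaussian bound over 1.  The exponential factor comes from
  \<open>|l x| \<le> x\<^sup>2 / (2 K\<^sup>2) + a\<close>.  The comparison is with \<open>exp a - 1\<close> rather than \<open>exp a\<close>, since for
  small \<open>l\<close> both sides of the subgaussian inequality are \<open>1 + O(l\<^sup>2)\<close>; this costs the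
  polynomial factor.
\<close>

lemma cosh_le_subgaussian:
  fixes x l K :: real
  assumes "K > 0"
  defines "a \<equiv> 1/2 * K\<^sup>2 * l\<^sup>2"
  shows "(exp (l * x) + exp (- (l * x))) / 2 - 1
      \<le> 3 * (1 + x\<^sup>2 / K\<^sup>2) * exp (x\<^sup>2 / (2 * K\<^sup>2)) * (exp a - 1)"
proof -
  define t where "t = l * x"
  define s where "s = x\<^sup>2 / (2 * K\<^sup>2)"
  have s: "s \<ge> 0" and a: "a \<ge> 0"
    by (simp_all add: s_def a_def)
  have t2: "t\<^sup>2 = 2 * a * (x\<^sup>2 / K\<^sup>2)"
    using assms by (simp add: t_def a_def power_mult_distrib)
  have "0 \<le> (K * \<bar>l\<bar> - \<bar>x\<bar> / K)\<^sup>2"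
    by simp
  also have "\<dots> = 2 * (s + a - \<bar>t\<bar>)"
    using \<open>K > 0\<close> by (simp add: s_def a_def t_def power2_diff power_mult_distrib power_divide abs_mult)
  finally have t_le: "exp \<bar>t\<bar> \<le> exp s * exp a"
    by (simp flip: exp_add)
  have "(exp t + exp (- t)) / 2 - 1 \<le> 3 * (1 + x\<^sup>2 / K\<^sup>2) * exp s * (exp a - 1)"
  proof (cases "a \<le> 1")
    case True
    have "exp a \<le> 3"
      using True exp_le order_trans[of "exp a" "exp 1" 3] by simp
    have "a \<le> exp a - 1"
      using exp_ge_add_one_self[of a] by linarith
    then have "a * exp a \<le> (exp a - 1) * 3"
      using a \<open>exp a \<le> 3\<close> by (intro mult_mono) simp_all
    have "(exp t + exp (- t)) / 2 - 1 \<le> t\<^sup>2 * exp \<bar>t\<bar> / 2"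
      using divide_right_mono[OF exp_add_exp_minus_le[of t], of 2] by (simp add: diff_divide_distrib)
    also have "\<dots> \<le> t\<^sup>2 * (exp s * exp a) / 2"
      using t_le by (intro divide_right_mono mult_left_mono) simp_all
    also have "\<dots> = (x\<^sup>2 / K\<^sup>2) * exp s * (a * exp a)"
      by (simp add: t2)
    also have "\<dots> \<le> (1 + x\<^sup>2 / K\<^sup>2) * exp s * ((exp a - 1) * 3)"
      by (rule mult_mono[OF _ \<open>a * exp a \<le> _\<close>]) (use a in \<open>simp_all add: distrib_right\<close>)
    finally show ?thesis
      by (simp add: algebra_simps)
  next
    case False
    have "2 \<le> exp a"
      using False exp_ge_add_one_self[of a] by linarith
    have "exp t + exp (- t) \<le> exp \<bar>t\<bar> + exp \<bar>t\<bar>"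
      by (intro add_mono) simp_all
    then have "(exp t + exp (- t)) / 2 \<le> exp \<bar>t\<bar>"
      by simp
    then have "(exp t + exp (- t)) / 2 - 1 \<le> exp \<bar>t\<bar> - 0"
      by (intro diff_mono) simp_all
    also have "\<dots> \<le> 1 * exp s * exp a"
      using t_le by simp
    also have "\<dots> \<le> (1 + x\<^sup>2 / K\<^sup>2) * exp s * ((exp a - 1) * 3)"
      using \<open>2 \<le> exp a\<close> by (intro mult_mono) simp_all
    finally show ?thesis
      by (simp add: algebra_simps)
  qed
  then show ?thesis
    by (simp add: t_def s_def)
qed

lemma pmf_nat_sums:
  fixes p :: "nat pmf"
  shows "pmf p sums 1"
proof -
  have eq: "(\<Sum>k. ennreal (pmf p k)) = 1"
    using nn_integral_pmf[of UNIV p] by (simp add: nn_integral_count_space_nat)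
  have summable: "summable (pmf p)"
    by (rule summable_suminf_not_top) (simp_all add: eq)
  have "ennreal (suminf (pmf p)) = 1"
    using suminf_ennreal2[OF _ summable] eq by simp
  then have "suminf (pmf p) = 1"
    by simp
  then show ?thesis
    using summable by (simp add: sums_iff)
qed

text \<open>
  Symmetry makes the mean zero and turns the moment generating function into a sum of hyperbolic
  cosines.
\<close>

definition symmetric_discrete :: "nat pmf \<Rightarrow> (nat \<Rightarrow> real) \<Rightarrow> real measure" where
  "symmetric_discrete p x =
     distr (measure_pmf (pair_pmf p (bernoulli_pmf (1/2)))) borel (\<lambda>(k, b). if b then x k else - x k)"

lemma symmetric_discrete_prob_space: "prob_space (symmetric_discrete p x)"
  unfolding symmetric_discrete_def by (intro measure_pmf.prob_space_distr) simp

lemma sets_symmetric_discrete[simp, measurable_cong]: "sets (symmetric_discrete p x) = sets borel"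
  by (simp add: symmetric_discrete_def)

lemma nn_integral_symmetric_discrete:
  assumes [measurable]: "f \<in> borel_measurable borel"
  shows "(\<integral>\<^sup>+z. f z \<partial>symmetric_discrete p x)
      = (\<Sum>k. ennreal (pmf p k) * (f (x k) * ennreal (1/2) + f (- x k) * ennreal (1/2)))"
proof -
  have "(\<integral>\<^sup>+z. f z \<partial>symmetric_discrete p x)
      = (\<integral>\<^sup>+k. \<integral>\<^sup>+b. f (if b then x k else - x k) \<partial>bernoulli_pmf (1/2) \<partial>p)"
    unfolding symmetric_discrete_def by (simp add: nn_integral_distr nn_integral_pair_pmf')
  also have "\<dots> = (\<integral>\<^sup>+k. f (x k) * ennreal (1/2) + f (- x k) * ennreal (1/2) \<partial>p)"
    by (intro nn_integral_cong) (simp add: ennreal_minus)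
  finally show ?thesis
    by (simp add: nn_integral_measure_pmf nn_integral_count_space_nat)
qed

lemma nn_integral_symmetric_discrete_real:
  fixes f :: "real \<Rightarrow> real"
  assumes [measurable]: "f \<in> borel_measurable borel" and "\<And>z. 0 \<le> f z"
  shows "(\<integral>\<^sup>+z. ennreal (f z) \<partial>symmetric_discrete p x)
      = (\<Sum>k. ennreal (pmf p k * ((f (x k) + f (- x k)) / 2)))"
proof -
  have "ennreal (q * ((a + b) / 2)) = ennreal q * (ennreal a * ennreal (1/2) + ennreal b * ennreal (1/2))"
    if "0 \<le> q" "0 \<le> a" "0 \<le> b" for q a b :: real
  proof -
    have "ennreal (q * ((a + b) / 2)) = ennreal (q * (a * (1/2) + b * (1/2)))"
      by (simp add: add_divide_distrib)
    also have "\<dots> = ennreal q * (ennreal a * ennreal (1/2) + ennreal b * ennreal (1/2))"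
      using that by (simp only: ennreal_mult ennreal_plus mult_nonneg_nonneg add_nonneg_nonneg
          zero_le_divide_1_iff zero_le_numeral)
    finally show ?thesis .
  qed
  then show ?thesis
    using assms(2) by (simp only: nn_integral_symmetric_discrete[OF measurable_compose[OF assms(1) measurable_ennreal]] pmf_nonneg)
qed

lemma symmetric_discrete_mean_zero: "(\<integral>z. z \<partial>symmetric_discrete p x) = 0"
proof -
  let ?P = "symmetric_discrete p x"
  have "?P = distr ?P borel uminus"
  proof (rule measure_eqI)
    fix A assume "A \<in> sets ?P"
    then have [measurable]: "A \<in> sets borel" by simp
    have "emeasure (distr ?P borel uminus) A = (\<integral>\<^sup>+z. indicator A z \<partial>distr ?P borel uminus)"
      by simp
    also have "\<dots> = (\<integral>\<^sup>+z. indicator A (- z) \<partial>?P)"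
      by (rule nn_integral_distr) simp_all
    also have "\<dots> = (\<integral>\<^sup>+z. indicator A z \<partial>?P)"
    proof -
      have "(\<lambda>z. indicator A (- z) :: ennreal) \<in> borel_measurable borel" "(indicator A :: _ \<Rightarrow> ennreal) \<in> borel_measurable borel"
        by measurable
      then show ?thesis
        by (simp only: nn_integral_symmetric_discrete minus_minus add.commute)
    qed
    finally show "emeasure ?P A = emeasure (distr ?P borel uminus) A"
      by simp
  qed simp
  then have "(\<integral>z. z \<partial>?P) = (\<integral>z. z \<partial>distr ?P borel uminus)"
    by (rule arg_cong)
  also have "\<dots> = - (\<integral>z. z \<partial>?P)"
    by (simp add: integral_distr)
  finally show ?thesis
    by simp
qed

lemma integrable_if_exp_moments:
  fixes P :: "real measure"
  assumes [measurable_cong]: "sets P = sets borel"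
    and "(\<integral>\<^sup>+z. ennreal (exp z) \<partial>P) < \<infinity>" "(\<integral>\<^sup>+z. ennreal (exp (- z)) \<partial>P) < \<infinity>"
  shows "integrable P (\<lambda>z. z)"
proof -
  have "integrable P (\<lambda>z. exp z + exp (- z))"
    using assms by (intro Bochner_Integration.integrable_add integrableI_nonneg) simp_all
  then show ?thesis
  proof (rule Bochner_Integration.integrable_bound)
    have "\<bar>z\<bar> \<le> exp z + exp (- z)" for z :: real
      using exp_ge_add_one_self[of z] exp_ge_add_one_self[of "- z"] exp_gt_zero[of z] exp_gt_zero[of "- z"]
      by linarith
    then show "AE z in P. norm z \<le> norm (exp z + exp (- z))"
      by (auto intro!: AE_I2 order_trans[OF _ abs_ge_self])
  qed simp
qed

text \<open>
  The weights are chosen such that the atoms \<open>\<plusminus>x k\<close> use at most the share \<open>(1/2) ^ k\<close> of the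
  excess \<open>exp a - 1\<close>.
\<close>

lemma symmetric_discrete_subgaussian:
  assumes "K > 0" "x 0 = 0"
    and weight: "\<And>k. k \<ge> 1 \<Longrightarrow>
      pmf p k * (3 * (1 + (x k)\<^sup>2 / K\<^sup>2) * exp ((x k)\<^sup>2 / (2 * K\<^sup>2))) \<le> (1/2) ^ k"
  shows "subgaussian K (symmetric_discrete p x)"
proof -
  let ?P = "symmetric_discrete p x"
  have bound: "(\<integral>\<^sup>+z. ennreal (exp (l * z)) \<partial>?P) \<le> ennreal (exp (1/2 * K\<^sup>2 * l\<^sup>2))" for l
  proof -
    define a where "a = 1/2 * K\<^sup>2 * l\<^sup>2"
    have a: "exp a - 1 \<ge> 0" by (simp add: a_def)
    define d where "d k = (if k = 0 then 0 else (1/2) ^ k * (exp a - 1))" for k :: nat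
    have d: "d k \<ge> 0" for k
      using a by (simp add: d_def)
    have "(\<lambda>k. d (Suc k)) sums (1 * (exp a - 1))"
      unfolding d_def using sums_mult2[OF power_half_series] by simp
    then have d_sums: "d sums (exp a - 1)"
      by (subst (asm) sums_Suc_iff) (simp add: d_def)
    have "(\<integral>\<^sup>+z. ennreal (exp (l * z)) \<partial>?P)
        = (\<Sum>k. ennreal (pmf p k * ((exp (l * x k) + exp (- (l * x k))) / 2)))"
      by (subst nn_integral_symmetric_discrete_real) simp_all
    also have "\<dots> \<le> (\<Sum>k. ennreal (pmf p k + d k))"
    proof (intro suminf_le)
      fix k
      have "pmf p k * ((exp (l * x k) + exp (- (l * x k))) / 2) \<le> pmf p k + d k"
      proof (cases "k = 0")
        case True
        then show ?thesis using \<open>x 0 = 0\<close> by (simp add: d_def)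
      next
        case False
        have "pmf p k * ((exp (l * x k) + exp (- (l * x k))) / 2 - 1)
            \<le> pmf p k * (3 * (1 + (x k)\<^sup>2 / K\<^sup>2) * exp ((x k)\<^sup>2 / (2 * K\<^sup>2)) * (exp a - 1))"
          unfolding a_def by (intro mult_left_mono cosh_le_subgaussian \<open>K > 0\<close>) simp
        also have "\<dots> = (pmf p k * (3 * (1 + (x k)\<^sup>2 / K\<^sup>2) * exp ((x k)\<^sup>2 / (2 * K\<^sup>2)))) * (exp a - 1)"
          by (simp only: mult.assoc)
        also have "\<dots> \<le> (1/2) ^ k * (exp a - 1)"
          using False a by (intro mult_right_mono weight) simp_all
        also have "\<dots> = d k"
          using False by (simp add: d_def)
        finally show ?thesis
          by (simp add: algebra_simps)
      qed
      then show "ennreal (pmf p k * ((exp (l * x k) + exp (- (l * x k))) / 2)) \<le> ennreal (pmf p k + d k)"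
        by (rule ennreal_leI)
    qed simp_all
    also have "\<dots> = ennreal (1 + (exp a - 1))"
      using d by (intro suminf_ennreal_eq sums_add pmf_nat_sums d_sums) simp
    also have "1 + (exp a - 1) = exp a"
      by simp
    finally show ?thesis
      unfolding a_def .
  qed
  have "integrable ?P (\<lambda>z. z)"
    using bound[of 1] bound[of "-1"]
    by (intro integrable_if_exp_moments) (auto intro: le_less_trans)
  then show ?thesis
    unfolding subgaussian_def symmetric_discrete_mean_zero
    using bound by (simp add: symmetric_discrete_prob_space)
qed

text \<open>The remaining mass is put on 0.\<close>

lemma exists_nat_pmf:
  fixes w :: "nat \<Rightarrow> real"
  assumes "\<And>k. k \<ge> 1 \<Longrightarrow> 0 \<le> w k" "\<And>k. k \<ge> 1 \<Longrightarrow> w k \<le> (1/2) ^ k"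
  shows "\<exists>p :: nat pmf. \<forall>k\<ge>1. pmf p k = w k"
proof -
  define w' where "w' k = w (Suc k)" for k
  have w': "0 \<le> w' k" "w' k \<le> (1/2) ^ Suc k" for k
    using assms[of "Suc k"] by (simp_all add: w'_def)
  have sum: "summable w'"
  proof (rule summable_comparison_test')
    show "summable (\<lambda>k. (1/2::real) ^ Suc k)"
      by (rule sums_summable[OF power_half_series])
    show "norm (w' k) \<le> (1/2) ^ Suc k" if "k \<ge> 0" for k
      using w'[of k] by simp
  qed
  have le: "suminf w' \<le> 1"
    by (rule sums_le[OF w'(2) summable_sums[OF sum] power_half_series])
  define q where "q k = (if k = 0 then 1 - suminf w' else w k)" for k
  have q: "0 \<le> q k" for k
    using assms(1)[of k] le by (cases "k = 0") (simp_all add: q_def)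
  have "(\<lambda>k. q (Suc k)) sums suminf w'"
    using summable_sums[OF sum] by (simp add: q_def flip: w'_def)
  then have "q sums (suminf w' + q 0)"
    by (subst (asm) sums_Suc_iff) simp
  then have "q sums 1"
    by (simp add: q_def)
  then have "(\<Sum>k. ennreal (q k)) = ennreal 1"
    by (rule suminf_ennreal_eq[OF q])
  then have "(\<integral>\<^sup>+k. ennreal (q k) \<partial>count_space UNIV) = 1"
    by (simp add: nn_integral_count_space_nat)
  then have "pmf (embed_pmf q) k = q k" for k
    using q by (rule_tac pmf_embed_pmf)
  then show ?thesis
    by (intro exI[of _ "embed_pmf q"]) (simp add: q_def)
qed

section \<open>Failure of the parametric rate above the noise level\<close>

text \<open>
  Geometric locations \<open>x k = B ^ k\<close> with weights \<open>exp (- \<beta> (x k)\<^sup>2)\<close>, where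
  \<open>1 / (2 K\<^sup>2) < \<beta> < 1 / (2 \<sigma>\<^sup>2)\<close>.  The left inequality leaves a factor
  \<open>exp (- \<delta> (x k)\<^sup>2)\<close> that pays for subgaussianity; the right one makes the tail at \<open>x k\<close> of a
  kernel centred at an earlier atom smaller than the weight of the atom \<open>x k\<close> itself, provided
  that \<open>B\<close> is so large that \<open>x k - x j\<close> is nearly \<open>x k\<close>.  This is where \<open>\<sigma> < K\<close> enters.
\<close>

lemma exists_sparse_atoms:
  fixes K \<sigma> :: real
  assumes "0 < \<sigma>" "\<sigma> < K"
  obtains x w :: "nat \<Rightarrow> real" where
    "x 0 = 0" "\<And>k. 0 \<le> x k" "\<And>j k. j < k \<Longrightarrow> x j + 1 < x k" "\<And>k. 0 < w k"
    "\<And>k. k \<ge> 1 \<Longrightarrow>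
      w k * (3 * (1 + (x k)\<^sup>2 / K\<^sup>2) * exp ((x k)\<^sup>2 / (2 * K\<^sup>2))) \<le> (1/2) ^ k"
    "\<And>j k. j < k \<Longrightarrow> exp (- (x k - x j)\<^sup>2 / (2 * \<sigma>\<^sup>2)) \<le> w k"
    "\<And>j k. k < j \<Longrightarrow> w j \<le> w k * w (j - 1)"
proof -
  have "K > 0" using assms by simp
  have "1 / (2 * K\<^sup>2) < 1 / (2 * \<sigma>\<^sup>2)"
    using assms by (intro divide_strict_left_mono) (simp_all add: power_strict_mono)
  then obtain \<beta> where \<beta>: "1 / (2 * K\<^sup>2) < \<beta>" "\<beta> < 1 / (2 * \<sigma>\<^sup>2)"
    using dense by blast
  have "\<beta> > 0"
    using \<beta>(1) \<open>K > 0\<close> by (smt (verit) zero_le_divide_1_iff zero_le_power2)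
  define \<delta> where "\<delta> = \<beta> - 1 / (2 * K\<^sup>2)"
  have \<delta>: "\<delta> > 0" using \<beta> by (simp add: \<delta>_def)
  \<comment> \<open>chosen such that the weight condition follows from \<open>C / (x k)\<^sup>2 \<le> (1/2) ^ k\<close>\<close>
  define C where "C = 6 * (1 + 1 / K\<^sup>2) / \<delta>\<^sup>2"
  have "\<forall>\<^sub>F B :: real in at_top. \<beta> < (1 - 1 / B)\<^sup>2 / (2 * \<sigma>\<^sup>2)"
  proof (rule order_tendstoD(1))
    show "((\<lambda>B. (1 - 1 / B)\<^sup>2 / (2 * \<sigma>\<^sup>2)) \<longlongrightarrow> (1 - 0)\<^sup>2 / (2 * \<sigma>\<^sup>2)) at_top"
      by (intro tendsto_intros tendsto_divide_0[OF tendsto_const] filterlim_at_top_imp_at_infinity filterlim_ident)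
         (use assms in simp)
  qed (use \<beta> in simp)
  moreover have "\<forall>\<^sub>F B :: real in at_top. 3 \<le> B \<and> C \<le> B"
    by (intro eventually_conj eventually_ge_at_top)
  ultimately have "\<forall>\<^sub>F B :: real in at_top. \<beta> < (1 - 1 / B)\<^sup>2 / (2 * \<sigma>\<^sup>2) \<and> 3 \<le> B \<and> C \<le> B"
    by eventually_elim simp
  then obtain B :: real where B: "\<beta> < (1 - 1 / B)\<^sup>2 / (2 * \<sigma>\<^sup>2)" "3 \<le> B" "C \<le> B"
    by (auto simp: eventually_at_top_linorder)
  define x where "x k = (if k = 0 then 0 else B ^ k)" for k :: nat
  define w where "w k = exp (- \<beta> * (x k)\<^sup>2)" for k
  have x_ge: "1 \<le> x k" if "k \<ge> 1" for k
    using that B by (simp add: x_def)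
  have x_nonneg: "0 \<le> x k" for k
    using B by (simp add: x_def)
  have x_step: "B * x j \<le> x k" if "j < k" for j k
  proof (cases "j = 0")
    case True
    then show ?thesis using x_nonneg by (simp add: x_def)
  next
    case False
    have "B ^ Suc j \<le> B ^ k"
      using that B by (intro power_increasing) simp_all
    then show ?thesis using False that by (simp add: x_def)
  qed
  have x_mono: "x j \<le> x k" if "j \<le> k" for j k
  proof (cases "j = k")
    case False
    then have "B * x j \<le> x k" using that x_step by simp
    moreover have "1 * x j \<le> B * x j" using B x_nonneg by (intro mult_right_mono) simp_all
    ultimately show ?thesis by simp
  qed simp
  have weight: "w k * (3 * (1 + (x k)\<^sup>2 / K\<^sup>2) * exp ((x k)\<^sup>2 / (2 * K\<^sup>2))) \<le> (1/2) ^ k" if "k \<ge> 1" for k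
  proof -
    define X where "X = (x k)\<^sup>2"
    have X: "X \<ge> 1" using x_ge[OF that] by (simp add: X_def)
    have "- \<beta> * X + X / (2 * K\<^sup>2) = - (\<delta> * X)"
      by (simp add: \<delta>_def algebra_simps)
    then have "exp (- \<beta> * X) * exp (X / (2 * K\<^sup>2)) = exp (- (\<delta> * X))"
      by (simp only: exp_add[symmetric])
    moreover have "exp (- (\<delta> * X)) \<le> 2 / (\<delta> * X)\<^sup>2"
    proof -
      have nonneg: "0 \<le> \<delta> * X"
        using \<delta> X by simp
      then have "(\<delta> * X)\<^sup>2 / 2 \<le> 1 + \<delta> * X + (\<delta> * X)\<^sup>2 / 2"
        by simp
      also have "\<dots> \<le> exp (\<delta> * X)"
        by (rule exp_lower_Taylor_quadratic[OF nonneg])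
      finally have "(\<delta> * X)\<^sup>2 / 2 \<le> exp (\<delta> * X)" .
      then show ?thesis
        using \<delta> X by (simp add: exp_minus field_simps)
    qed
    moreover have "1 + X / K\<^sup>2 \<le> (1 + 1 / K\<^sup>2) * X"
      using X by (simp add: algebra_simps)
    ultimately have "3 * (1 + X / K\<^sup>2) * (exp (- \<beta> * X) * exp (X / (2 * K\<^sup>2)))
        \<le> 3 * ((1 + 1 / K\<^sup>2) * X) * (2 / (\<delta> * X)\<^sup>2)"
      using X by (intro mult_mono) simp_all
    also have "\<dots> = C / X"
      using X \<delta> by (simp add: C_def power2_eq_square field_simps)
    also have "\<dots> \<le> B / (B * B ^ k)"
    proof (intro frac_le)
      have "B * B ^ k \<le> B ^ (2 * k)"
        using that B power_increasing[of "Suc k" "2 * k" B] by simp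
      then show "B * B ^ k \<le> X"
        using that by (simp add: X_def x_def power_mult[symmetric] mult.commute)
    qed (use B in simp_all)
    also have "\<dots> = (1 / B) ^ k"
      using B by (simp add: power_divide)
    also have "\<dots> \<le> (1/2) ^ k"
      using B by (intro power_mono) (simp_all add: field_simps)
    finally show ?thesis
      by (simp add: w_def X_def mult_ac)
  qed
  have gap: "x j + 1 < x k" if "j < k" for j k
  proof (cases "j = 0")
    case True
    then show ?thesis
      using x_step[OF that] x_mono[of 1 k] that B by (simp add: x_def)
  next
    case False
    have "3 * x j \<le> B * x j"
      using B x_nonneg by (intro mult_right_mono) simp_all
    also have "\<dots> \<le> x k"
      using that by (rule x_step)
    finally show ?thesis
      using x_ge[of j] False by simp
  qed
  have below: "exp (- (x k - x j)\<^sup>2 / (2 * \<sigma>\<^sup>2)) \<le> w k" if "j < k" for j k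
  proof -
    have "x j \<le> x k / B"
      using x_step[OF that] B by (simp add: field_simps)
    then have "x k * (1 - 1 / B) \<le> x k - x j"
      by (simp add: algebra_simps)
    moreover have "0 \<le> x k * (1 - 1 / B)"
      using x_nonneg B by simp
    ultimately have "(x k * (1 - 1 / B))\<^sup>2 \<le> (x k - x j)\<^sup>2"
      by (intro power_mono)
    then have "(x k)\<^sup>2 * ((1 - 1 / B)\<^sup>2 / (2 * \<sigma>\<^sup>2)) \<le> (x k - x j)\<^sup>2 / (2 * \<sigma>\<^sup>2)"
      by (simp add: power_mult_distrib divide_right_mono)
    moreover have "(x k)\<^sup>2 * \<beta> \<le> (x k)\<^sup>2 * ((1 - 1 / B)\<^sup>2 / (2 * \<sigma>\<^sup>2))"
      using B(1) by (intro mult_left_mono) simp_all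
    ultimately have "\<beta> * (x k)\<^sup>2 \<le> (x k - x j)\<^sup>2 / (2 * \<sigma>\<^sup>2)"
      by (simp only: mult.commute)
    then show ?thesis
      by (simp add: w_def)
  qed
  have above: "w j \<le> w k * w (j - 1)" if "k < j" for j k
  proof -
    have j: "k \<le> j - 1" "j - 1 < j"
      using that by simp_all
    have "(x k)\<^sup>2 + (x (j - 1))\<^sup>2 \<le> 2 * (x (j - 1))\<^sup>2"
      using power_mono[OF x_mono[OF j(1)] x_nonneg, of 2] by simp
    also have "\<dots> \<le> B\<^sup>2 * (x (j - 1))\<^sup>2"
      using power_mono[of 3 B 2] B by (intro mult_right_mono) simp_all
    also have "\<dots> = (B * x (j - 1))\<^sup>2"
      by (simp add: power_mult_distrib)
    also have "\<dots> \<le> (x j)\<^sup>2"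
      using x_step[OF j(2)] B x_nonneg by (intro power_mono) simp_all
    finally have "\<beta> * ((x k)\<^sup>2 + (x (j - 1))\<^sup>2) \<le> \<beta> * (x j)\<^sup>2"
      using \<open>\<beta> > 0\<close> by (intro mult_left_mono) simp_all
    then show ?thesis
      unfolding w_def exp_add[symmetric] by (simp add: algebra_simps)
  qed
  have "x 0 = 0" and "0 < w k" for k
    by (simp_all add: x_def w_def)
  from that[OF this(1) x_nonneg gap this(2) weight below above] show ?thesis .
qed

text \<open>
  On \<open>[x k, x k + 1]\<close> the mixture density is at most a constant times the mass of the atom
  \<open>x k\<close>: the kernels of the earlier atoms are in their tails there, and the later atoms
  together have at most that mass.  The second moment of the kernel is at least a constant times
  that mass.  So the
  integrand is bounded below on infinitely many disjoint intervals of length one.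
\<close>

lemma sparse_atoms_infinite_integral:
  fixes x :: "nat \<Rightarrow> real" and p :: "nat pmf"
  assumes "0 < \<sigma>" and x_nonneg: "\<And>k. 0 \<le> x k" and gap: "\<And>j k. j < k \<Longrightarrow> x j + 1 < x k"
    and mass_pos: "\<And>k. k \<ge> 1 \<Longrightarrow> 0 < pmf p k"
    and below: "\<And>j k. j < k \<Longrightarrow> exp (- (x k - x j)\<^sup>2 / (2 * \<sigma>\<^sup>2)) \<le> pmf p k"
    and above: "\<And>j k. 1 \<le> k \<Longrightarrow> k < j \<Longrightarrow> pmf p j \<le> pmf p k * pmf p (j - 1)"
  defines "P \<equiv> symmetric_discrete p x"
  shows "(\<integral>\<^sup>+y. ennreal (mixture_second_moment \<sigma> P y / mixture_density \<sigma> P y) \<partial>lborel) = \<infinity>"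
proof -
  have ps: "prob_space P" and s: "sets P = sets borel"
    by (simp_all add: P_def symmetric_discrete_prob_space)
  let ?g = "gauss_kernel \<sigma> :: real \<Rightarrow> real"
  define g0 where "g0 = ?g 0"
  define g1 where "g1 = ?g 1"
  have g0: "g0 > 0" and g1: "g1 > 0"
    unfolding g0_def g1_def using gauss_kernel_pos[OF \<open>0 < \<sigma>\<close>] by auto
  have g_eq: "?g z = g0 * exp (- z\<^sup>2 / (2 * \<sigma>\<^sup>2))" for z
    unfolding g0_def using \<open>0 < \<sigma>\<close> by (simp add: gauss_kernel_eq)
  have g_anti: "?g z \<le> ?g z'" if "\<bar>z'\<bar> \<le> \<bar>z\<bar>" for z z'
    unfolding g_eq using that g0 by (intro mult_left_mono) (simp_all add: divide_right_mono abs_le_square_iff)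
  have g_le: "?g z \<le> g0" for z
    unfolding g0_def by (rule gauss_kernel_le[OF \<open>0 < \<sigma>\<close>])
  \<comment> \<open>summed over \<open>j\<close>, the bracket gives at most 3, one unit for each of \<open>j < k\<close>, \<open>j = k\<close>, \<open>j > k\<close>\<close>
  have pw: "pmf p j * ?g (y - z)
      \<le> g0 * pmf p k * (pmf p j + of_bool (j = k) + (if j = 0 then 0 else pmf p (j - 1)))"
    (is "_ \<le> ?R") if k: "k \<ge> 1" and y: "x k \<le> y" and z: "\<bar>z\<bar> = x j" for k y j z
  proof -
    consider "j < k" | "j = k" | "k < j" by linarith
    then show ?thesis
    proof cases
      case 1
      have "?g (y - z) \<le> ?g (x k - x j)"
        using y z gap[OF 1] by (intro g_anti) simp
      also have "\<dots> \<le> g0 * pmf p k"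
        unfolding g_eq using g0 below[OF 1] by (intro mult_left_mono) simp_all
      finally have "pmf p j * ?g (y - z) \<le> pmf p j * (g0 * pmf p k)"
        by (intro mult_left_mono) simp_all
      also have "\<dots> \<le> ?R"
        using g0 by (simp add: algebra_simps)
      finally show ?thesis .
    next
      case 2
      then have "pmf p j * ?g (y - z) \<le> pmf p k * g0"
        using g_le by (intro mult_mono) simp_all
      also have "\<dots> \<le> ?R"
        using 2 g0 by (simp add: algebra_simps)
      finally show ?thesis .
    next
      case 3
      have "pmf p j * ?g (y - z) \<le> (pmf p k * pmf p (j - 1)) * g0"
        using above[OF k 3] g_le by (intro mult_mono) simp_all
      also have "\<dots> \<le> ?R"
        using 3 g0 by (simp add: algebra_simps)
      finally show ?thesis .
    qed
  qed
  have average_le: "(a + b) / 2 \<le> c" if "a \<le> c" "b \<le> c" for a b c :: real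
    using that by simp
  have density_le: "mixture_density \<sigma> P y \<le> 3 * g0 * pmf p k" if k: "k \<ge> 1" and y: "x k \<le> y" for k y
  proof -
    define e where "e j = (if j = 0 then 0 else pmf p (j - 1))" for j
    have wk: "pmf p k > 0" by (rule mass_pos[OF k])
    have "(\<lambda>j. e (Suc j)) sums 1"
      using pmf_nat_sums[of p] by (simp add: e_def)
    then have e: "e sums 1"
      by (subst (asm) sums_Suc_iff) (simp add: e_def)
    have "(\<lambda>j. if j = k then 1 else 0 :: real) sums 1"
      by (rule sums_single)
    then have "(\<lambda>j. of_bool (j = k) :: real) sums 1"
      by (simp add: of_bool_def)
    then have "(\<lambda>j. g0 * pmf p k * (pmf p j + of_bool (j = k) + e j)) sums (g0 * pmf p k * (1 + 1 + 1))"
      by (intro sums_mult sums_add pmf_nat_sums e)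
    then have total: "(\<Sum>j. ennreal (g0 * pmf p k * (pmf p j + of_bool (j = k) + e j))) = ennreal (g0 * pmf p k * (1 + 1 + 1))"
      using g0 wk by (intro suminf_ennreal_eq) (simp_all add: e_def)
    have "ennreal (mixture_density \<sigma> P y) = (\<integral>\<^sup>+z. ennreal (?g (y - z)) \<partial>P)"
      by (rule mixture_density_eq_nn_integral[OF ps s \<open>0 < \<sigma>\<close>])
    also have "\<dots> = (\<Sum>j. ennreal (pmf p j * ((?g (y - x j) + ?g (y - - x j)) / 2)))"
      unfolding P_def by (rule nn_integral_symmetric_discrete_real) simp_all
    also have "\<dots> \<le> (\<Sum>j. ennreal (g0 * pmf p k * (pmf p j + of_bool (j = k) + e j)))"
    proof (intro suminf_le)
      fix j
      have "pmf p j * ((?g (y - x j) + ?g (y - - x j)) / 2)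
          = (pmf p j * ?g (y - x j) + pmf p j * ?g (y - - x j)) / 2"
        by (simp add: distrib_left)
      also have "\<dots> \<le> g0 * pmf p k * (pmf p j + of_bool (j = k) + e j)"
        using x_nonneg[of j] by (intro average_le pw[OF k y, folded e_def]) simp_all
      finally show "ennreal (pmf p j * ((?g (y - x j) + ?g (y - - x j)) / 2))
          \<le> ennreal (g0 * pmf p k * (pmf p j + of_bool (j = k) + e j))"
        by (rule ennreal_leI)
    qed simp_all
    also have "\<dots> = ennreal (3 * g0 * pmf p k)"
      unfolding total by (simp add: mult_ac)
    finally show ?thesis
      using g0 wk by (subst (asm) ennreal_le_iff) simp_all
  qed
  have second_ge: "pmf p k / 2 * g1\<^sup>2 \<le> mixture_second_moment \<sigma> P y" if k: "k \<ge> 1" and y: "x k \<le> y" "y \<le> x k + 1" for k y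
  proof -
    have "g1 \<le> ?g (y - x k)"
      unfolding g1_def using y by (intro g_anti) simp
    then have g: "g1\<^sup>2 \<le> (?g (y - x k))\<^sup>2"
      using g1 by (intro power_mono) simp_all
    define t where "t j = pmf p j * (((?g (y - x j))\<^sup>2 + (?g (y - - x j))\<^sup>2) / 2)" for j
    have "pmf p k / 2 * g1\<^sup>2 = pmf p k * ((g1\<^sup>2 + 0) / 2)"
      by simp
    also have "\<dots> \<le> t k"
      unfolding t_def using g by (intro mult_left_mono divide_right_mono add_mono) simp_all
    finally have "ennreal (pmf p k / 2 * g1\<^sup>2) \<le> ennreal (t k)"
      by (rule ennreal_leI)
    also have "\<dots> \<le> (\<Sum>j. ennreal (t j))"
      using sum_le_suminf[OF summableI, of "{k}" "\<lambda>j. ennreal (t j)"] by simp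
    also have "\<dots> = (\<integral>\<^sup>+z. ennreal ((?g (y - z))\<^sup>2) \<partial>P)"
      unfolding P_def t_def by (rule nn_integral_symmetric_discrete_real[where f="\<lambda>z. (?g (y - z))\<^sup>2", symmetric]) simp_all
    also have "\<dots> = ennreal (mixture_second_moment \<sigma> P y)"
      unfolding mixture_second_moment_def
      using gauss_kernel_square_integrable[OF ps s \<open>0 < \<sigma>\<close>] by (simp add: nn_integral_eq_integral)
    finally show ?thesis
      by (subst (asm) ennreal_le_iff) (simp_all add: mixture_second_moment_def)
  qed
  define c where "c = g1\<^sup>2 / (6 * g0)"
  have c: "c > 0" using g0 g1 by (simp add: c_def)
  define J where "J k = {x (Suc k) .. x (Suc k) + 1}" for k
  have disj: "disjoint_family J"
  proof -
    have "J i \<inter> J j = {}" if "i < j" for i j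
      using gap[of "Suc i" "Suc j"] that by (auto simp: J_def)
    then show ?thesis
      unfolding disjoint_family_on_def by (metis Int_commute linorder_neqE_nat)
  qed
  have ratio_ge: "ennreal c * indicator (\<Union>k. J k) y \<le> ennreal (mixture_second_moment \<sigma> P y / mixture_density \<sigma> P y)" for y
  proof (cases "y \<in> (\<Union>k. J k)")
    case True
    then obtain k where k: "k \<ge> 1" "x k \<le> y" "y \<le> x k + 1"
      by (auto simp: J_def)
    have "c * (3 * g0 * pmf p k) = pmf p k / 2 * g1\<^sup>2"
      using g0 by (simp add: c_def field_simps)
    also have "\<dots> \<le> mixture_second_moment \<sigma> P y"
      by (rule second_ge[OF k])
    finally have "c * mixture_density \<sigma> P y \<le> mixture_second_moment \<sigma> P y"
      using mult_left_mono[OF density_le[OF k(1,2)], of c] c by linarith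
    then have "c \<le> mixture_second_moment \<sigma> P y / mixture_density \<sigma> P y"
      using mixture_density_pos[OF ps s \<open>0 < \<sigma>\<close>, of y] by (simp add: pos_le_divide_eq)
    then show ?thesis
      using True by (simp add: ennreal_leI)
  qed simp
  have "emeasure lborel (\<Union>k. J k) = (\<Sum>k. emeasure lborel (J k))"
    by (rule suminf_emeasure[OF _ disj, symmetric]) (auto simp: J_def)
  also have "\<dots> = (\<Sum>k::nat. 1)"
    by (simp add: J_def)
  also have "\<dots> = (\<integral>\<^sup>+k. 1 \<partial>count_space (UNIV :: nat set))"
    by (rule nn_integral_count_space_nat[symmetric])
  also have "\<dots> = \<infinity>"
    by simp
  finally have "\<infinity> = (\<integral>\<^sup>+y. ennreal c * indicator (\<Union>k. J k) y \<partial>lborel)"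
    using c by (subst nn_integral_cmult_indicator) (auto simp: J_def ennreal_mult_top)
  also have "\<dots> \<le> (\<integral>\<^sup>+y. ennreal (mixture_second_moment \<sigma> P y / mixture_density \<sigma> P y) \<partial>lborel)"
    by (intro nn_integral_mono ratio_ge)
  finally show ?thesis
    by (simp add: top_unique)
qed

theorem smoothed_KL_not_parametric:
  fixes K \<sigma> :: real
  assumes "0 < \<sigma>" "\<sigma> < K"
  shows "\<exists>P :: real measure. subgaussian K P \<and>
    (\<lambda>n::nat. of_nat n * expected_smoothed_KL \<sigma> P n) \<longlonglongrightarrow> \<infinity>"
proof -
  obtain x w :: "nat \<Rightarrow> real" where x: "x 0 = 0" "\<And>k. 0 \<le> x k" "\<And>j k. j < k \<Longrightarrow> x j + 1 < x k"
    and w: "\<And>k. 0 < w k"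
    and weight: "\<And>k. k \<ge> 1 \<Longrightarrow>
      w k * (3 * (1 + (x k)\<^sup>2 / K\<^sup>2) * exp ((x k)\<^sup>2 / (2 * K\<^sup>2))) \<le> (1/2) ^ k"
    and below: "\<And>j k. j < k \<Longrightarrow> exp (- (x k - x j)\<^sup>2 / (2 * \<sigma>\<^sup>2)) \<le> w k"
    and above: "\<And>j k. k < j \<Longrightarrow> w j \<le> w k * w (j - 1)"
    by (rule exists_sparse_atoms[OF assms]) (rule that)
  have w_le: "w k \<le> (1/2) ^ k" if "k \<ge> 1" for k
  proof -
    have "1 * 1 * 1 \<le> 3 * (1 + (x k)\<^sup>2 / K\<^sup>2) * exp ((x k)\<^sup>2 / (2 * K\<^sup>2))"
      by (intro mult_mono) simp_all
    then have "w k * 1 \<le> w k * (3 * (1 + (x k)\<^sup>2 / K\<^sup>2) * exp ((x k)\<^sup>2 / (2 * K\<^sup>2)))"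
      by (intro mult_left_mono) (simp_all only: less_imp_le[OF w] mult_1_left)
    then show ?thesis using weight[OF that] by linarith
  qed
  obtain p :: "nat pmf" where p: "\<forall>k\<ge>1. pmf p k = w k"
    using exists_nat_pmf[OF less_imp_le[OF w] w_le] by blast
  define P where "P = symmetric_discrete p x"
  have "subgaussian K P"
    unfolding P_def using p weight x(1) assms by (intro symmetric_discrete_subgaussian) simp_all
  moreover have "(\<integral>\<^sup>+y. ennreal (mixture_second_moment \<sigma> P y / mixture_density \<sigma> P y) \<partial>lborel) = \<infinity>"
    unfolding P_def
  proof (rule sparse_atoms_infinite_integral[OF assms(1) x(2,3)])
    fix j k :: nat
    show "0 < pmf p k" if "1 \<le> k"
      using p w that by simp
    show "exp (- (x k - x j)\<^sup>2 / (2 * \<sigma>\<^sup>2)) \<le> pmf p k" if "j < k"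
      using p below[OF that] that by simp
    show "pmf p j \<le> pmf p k * pmf p (j - 1)" if "1 \<le> k" "k < j"
      using p above[OF that(2)] that by simp
  qed
  then have "(\<lambda>n. of_nat n * expected_smoothed_KL \<sigma> P n) \<longlonglongrightarrow> \<infinity>"
    using assms(1)
    by (intro expected_smoothed_KL_superlinear) (simp_all add: P_def symmetric_discrete_prob_space)
  ultimately show ?thesis
    by blast
qed

theorem mainTheorem5:
  fixes K \<sigma> :: real
  assumes "K > 0" and "\<sigma> > 0"
  shows "(K < \<sigma> \<longrightarrow>
           (\<exists>C::real. \<forall>P :: (real ^ 'd) measure. subgaussian K P \<longrightarrow>
              (\<forall>n::nat. n \<ge> 1 \<longrightarrow> expected_smoothed_KL \<sigma> P n \<le> ennreal (C / real n))))
       \<and> (K > \<sigma> \<longrightarrow>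
           (\<exists>P :: real measure. subgaussian K P \<and>
              ((\<lambda>n::nat. of_nat n * expected_smoothed_KL \<sigma> P n) \<longlongrightarrow> \<infinity>) sequentially))"
  using smoothed_KL_parametric_rate[of K \<sigma>, where 'a="real ^ 'd"] smoothed_KL_not_parametric[of \<sigma> K] assms
  by blast

end
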